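(* Consider the depth $m=1$ AA-Picard iteration for the steady Navier–Stokes equations with the $H^1_0$ norm used for the AA optimization, as described in the context. Suppose there is $\sigma>0$ with $\sigma\|\nabla e_j\|\le \|\nabla(w_{j+1}-w_j)\|$ for all $j$, suppose $0<|\alpha^k_j|<\bar\alpha$ for all $k,j$ for some fixed $\bar\alpha$, and suppose the residual differences $\{w_j-w_{j-1}\}_{j=1,\dots,k}$ are not linearly dependent in the $H^1_0$ inner product. Let $K$ be a constant with $\|\nabla e_j\|\le K\|\nabla w_j\|$ for all $j$. Then \[ \|\nabla w_{k+1}\| \le \kappa\, (\theta^{L^2}_{k,1})^{1/2}(\theta^{H^1_0}_{k,1})^{1/2}\left(\frac{\|\alpha^k_k w_k+\alpha^k_{k-1}w_{k-1}\|}{\|\hat\alpha^k_k w_k+\hat\alpha^k_{k-1}w_{k-1}\|}\right)^{1/2}\left(\frac{\|w_k\|}{C_P\|\nabla w_k\|}\right)^{1/2}\|\nabla w_k\| + K^2 M\nu^{-1}\kappa\,\bar\alpha\,\|\nabla w_k\|\,\|\nabla w_{k-1}\|. \]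
   Context: Let $\Omega\subset\mathbb{R}^d$, $d\in\{2,3\}$, be a bounded open connected domain; $(\cdot,\cdot)$ and $\|\cdot\|$ denote the $L^2(\Omega)$ inner product and norm, $\|\cdot\|_{-1}$ the $H^{-1}(\Omega)$ norm and $\langle\cdot,\cdot\rangle$ the $H^{-1}$–$H^1_0$ duality pairing. $X=H^1_0(\Omega)^d$, $Q=\{q\in L^2(\Omega):\int_\Omega q=0\}$. $C_P$ is the Poincaré constant: $\|\phi\|\le C_P\|\nabla\phi\|$ for $\phi\in X$. $b^*(v,w,z)=(v\cdot\nabla w,z)+\tfrac12((\nabla\cdot v)w,z)$. $M:=C_P^{1/2}C_3C_6$, where $\|\phi\|_{L^6}\le C_6\|\nabla\phi\|$ and $\|\phi\|_{L^3}\le C_3\|\phi\|^{1/2}\|\nabla\phi\|^{1/2}$ for $\phi\in X$. Let $X_h\subset X$, $Q_h\subset Q$ be conforming finite element spaces satisfying the inf-sup condition $\sup_{0\ne v\in X_h}(\nabla\cdot v,q)/\|\nabla v\|\ge\beta\|q\|$ for all $q\in Q_h$ with $\beta>0$, and $V_h=\{v\in X_h:(\nabla\cdot v,q)=0\ \forall q\in Q_h\}$. Let $\nu>0$, $f\in H^{-1}(\Omega)$, and $\kappa:=M\nu^{-2}\|f\|_{-1}$ (no smallness assumed). The Picard operator $g:V_h\to V_h$ maps $u$ to the unique $g(u)\in V_h$ with $\nu(\nabla g(u),\nabla v)+b^*(u,g(u),v)=\langle f,v\rangle$ for all $v\in V_h$. AA-Picard of depth $m$ (no damping): set $\tilde u_j:=g(u_{j-1})$,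 $w_j:=\tilde u_j-u_{j-1}$, $e_j:=u_j-u_{j-1}$; at step $k$ the coefficients $(\alpha^k_j)_{j=k-m}^k$ minimize $\|\nabla\sum_{j=k-m}^k\alpha_jw_j\|$ subject to $\sum_j\alpha_j=1$, and $u_k=\sum_{j=k-m}^k\alpha^k_j\tilde u_j$. $(\hat\alpha^k_j)_{j=k-m}^k$ denote the minimizers of $\|\sum_{j=k-m}^k\alpha_jw_j\|$ ($L^2$ norm) subject to $\sum_j\alpha_j=1$, for the same residuals. Gains: $\theta^{H^1_0}_{k,m}=\|\nabla\sum_{j=k-m}^k\alpha^k_jw_j\|/\|\nabla w_k\|$ and $\theta^{L^2}_{k,m}=\|\sum_{j=k-m}^k\hat\alpha^k_jw_j\|/\|w_k\|$. The paper notes that under the $\sigma$-assumption a constant $K$ as in the claim exists (depending on $\sigma$, the gain and the degree of linear independence of the residual differences). *)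

theory Defs
  imports "HOL-Analysis.Analysis"
begin

definition partial_at :: "'d::finite \<Rightarrow> (real^'d \<Rightarrow> real) \<Rightarrow> real^'d \<Rightarrow> real" where
  "partial_at i f x = (SOME D. ((\<lambda>t. f (x + t *\<^sub>R axis i 1)) has_real_derivative D) (at 0))"

fun iterpart :: "'d::finite list \<Rightarrow> (real^'d \<Rightarrow> real) \<Rightarrow> real^'d \<Rightarrow> real" where
  "iterpart [] f = f"
| "iterpart (i # is) f = partial_at i (iterpart is f)"

definition smooth_fun :: "(real^'d::finite \<Rightarrow> real) \<Rightarrow> bool" where
  "smooth_fun f \<longleftrightarrow> (\<forall>is. iterpart is f differentiable_on UNIV)"

definition test_fun :: "(real^'d::finite) set \<Rightarrow> (real^'d \<Rightarrow> real) \<Rightarrow> bool" where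
  "test_fun \<Omega> \<phi> \<longleftrightarrow> smooth_fun \<phi> \<and> compact (closure {x. \<phi> x \<noteq> 0})
      \<and> closure {x. \<phi> x \<noteq> 0} \<subseteq> \<Omega>"

definition cgrad :: "(real^'d::finite \<Rightarrow> real^'d) \<Rightarrow> real^'d \<Rightarrow> real^'d^'d" where
  "cgrad \<phi> x = (\<chi> i l. partial_at l (\<lambda>y. \<phi> y $ i) x)"

definition L2fun :: "(real^'d::finite) set \<Rightarrow> (real^'d \<Rightarrow> 'b::euclidean_space) \<Rightarrow> bool" where
  "L2fun \<Omega> u \<longleftrightarrow> set_borel_measurable lebesgue \<Omega> u
      \<and> set_integrable lebesgue \<Omega> (\<lambda>x. (norm (u x))\<^sup>2)"

definition Lpn :: "real \<Rightarrow> (real^'d::finite) set \<Rightarrow> (real^'d \<Rightarrow> 'b::real_normed_vector) \<Rightarrow> real" where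
  "Lpn p \<Omega> u = (LINT x:\<Omega>|lebesgue. (norm (u x)) powr p) powr (1 / p)"

definition L2n :: "(real^'d::finite) set \<Rightarrow> (real^'d \<Rightarrow> 'b::real_normed_vector) \<Rightarrow> real" where
  "L2n \<Omega> u = sqrt (LINT x:\<Omega>|lebesgue. (norm (u x))\<^sup>2)"

definition weak_grad :: "(real^'d::finite) set \<Rightarrow> (real^'d \<Rightarrow> real^'d) \<Rightarrow> (real^'d \<Rightarrow> real^'d^'d) \<Rightarrow> bool" where
  "weak_grad \<Omega> u G \<longleftrightarrow> (\<forall>\<phi> i l. test_fun \<Omega> \<phi> \<longrightarrow>
      set_integrable lebesgue \<Omega> (\<lambda>x. u x $ i * partial_at l \<phi> x)
    \<and> set_integrable lebesgue \<Omega> (\<lambda>x. G x $ i $ l * \<phi> x)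
    \<and> (LINT x:\<Omega>|lebesgue. u x $ i * partial_at l \<phi> x) = - (LINT x:\<Omega>|lebesgue. G x $ i $ l * \<phi> x))"

definition grad :: "(real^'d::finite) set \<Rightarrow> (real^'d \<Rightarrow> real^'d) \<Rightarrow> real^'d \<Rightarrow> real^'d^'d" where
  "grad \<Omega> u = (SOME G. weak_grad \<Omega> u G)"

definition divg :: "(real^'d::finite) set \<Rightarrow> (real^'d \<Rightarrow> real^'d) \<Rightarrow> real^'d \<Rightarrow> real" where
  "divg \<Omega> u x = (\<Sum>i\<in>UNIV. grad \<Omega> u x $ i $ i)"

definition H10 :: "(real^'d::finite) set \<Rightarrow> (real^'d \<Rightarrow> real^'d) set" where
  "H10 \<Omega> = {u. L2fun \<Omega> u \<and> (\<exists>G. weak_grad \<Omega> u G \<and> L2fun \<Omega> G \<and>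
      (\<exists>\<phi> :: nat \<Rightarrow> real^'d \<Rightarrow> real^'d.
         (\<forall>n i. test_fun \<Omega> (\<lambda>x. \<phi> n x $ i))
       \<and> (\<lambda>n. L2n \<Omega> (\<lambda>x. \<phi> n x - u x)) \<longlonglongrightarrow> 0
       \<and> (\<lambda>n. L2n \<Omega> (\<lambda>x. cgrad (\<phi> n) x - G x)) \<longlonglongrightarrow> 0))}"

definition Q0 :: "(real^'d::finite) set \<Rightarrow> (real^'d \<Rightarrow> real) set" where
  "Q0 \<Omega> = {q. L2fun \<Omega> q \<and> (LINT x:\<Omega>|lebesgue. q x) = 0}"

definition h1n :: "(real^'d::finite) set \<Rightarrow> (real^'d \<Rightarrow> real^'d) \<Rightarrow> real" where
  "h1n \<Omega> u = L2n \<Omega> (grad \<Omega> u)"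

definition h1ip :: "(real^'d::finite) set \<Rightarrow> (real^'d \<Rightarrow> real^'d) \<Rightarrow> (real^'d \<Rightarrow> real^'d) \<Rightarrow> real" where
  "h1ip \<Omega> u v = (LINT x:\<Omega>|lebesgue. grad \<Omega> u x \<bullet> grad \<Omega> v x)"

definition hm1n :: "(real^'d::finite) set \<Rightarrow> ((real^'d \<Rightarrow> real^'d) \<Rightarrow> real) \<Rightarrow> real" where
  "hm1n \<Omega> f = Sup {\<bar>f \<phi>\<bar> / h1n \<Omega> \<phi> | \<phi>. \<phi> \<in> H10 \<Omega> \<and> h1n \<Omega> \<phi> \<noteq> 0}"

definition in_Hm1 :: "(real^'d::finite) set \<Rightarrow> ((real^'d \<Rightarrow> real^'d) \<Rightarrow> real) \<Rightarrow> bool" where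
  "in_Hm1 \<Omega> f \<longleftrightarrow>
     (\<forall>\<phi>\<in>H10 \<Omega>. \<forall>\<psi>\<in>H10 \<Omega>. \<forall>a b. f (\<lambda>x. a *\<^sub>R \<phi> x + b *\<^sub>R \<psi> x) = a * f \<phi> + b * f \<psi>)
   \<and> (\<exists>C. \<forall>\<phi>\<in>H10 \<Omega>. \<bar>f \<phi>\<bar> \<le> C * h1n \<Omega> \<phi>)"

definition bstar :: "(real^'d::finite) set \<Rightarrow> (real^'d \<Rightarrow> real^'d) \<Rightarrow> (real^'d \<Rightarrow> real^'d) \<Rightarrow> (real^'d \<Rightarrow> real^'d) \<Rightarrow> real" where
  "bstar \<Omega> v w z = (LINT x:\<Omega>|lebesgue. (grad \<Omega> w x *v v x) \<bullet> z x)
      + 1/2 * (LINT x:\<Omega>|lebesgue. divg \<Omega> v x * (w x \<bullet> z x))"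

definition fin_subspace :: "('a \<Rightarrow> 'b::real_vector) set \<Rightarrow> bool" where
  "fin_subspace S \<longleftrightarrow> (\<lambda>x. 0) \<in> S
     \<and> (\<forall>u\<in>S. \<forall>v\<in>S. \<forall>a b. (\<lambda>x. a *\<^sub>R u x + b *\<^sub>R v x) \<in> S)
     \<and> (\<exists>B. finite B \<and> B \<subseteq> S \<and> (\<forall>v\<in>S. \<exists>c. v = (\<lambda>x. \<Sum>b\<in>B. c b *\<^sub>R b x)))"

definition inf_sup :: "(real^'d::finite) set \<Rightarrow> (real^'d \<Rightarrow> real^'d) set \<Rightarrow> (real^'d \<Rightarrow> real) set \<Rightarrow> real \<Rightarrow> bool" where
  "inf_sup \<Omega> Xh Qh \<beta> \<longleftrightarrow> (\<forall>q\<in>Qh.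
     Sup {(LINT x:\<Omega>|lebesgue. divg \<Omega> v x * q x) / h1n \<Omega> v | v. v \<in> Xh \<and> h1n \<Omega> v \<noteq> 0}
       \<ge> \<beta> * L2n \<Omega> q)"

definition Vh :: "(real^'d::finite) set \<Rightarrow> (real^'d \<Rightarrow> real^'d) set \<Rightarrow> (real^'d \<Rightarrow> real) set \<Rightarrow> (real^'d \<Rightarrow> real^'d) set" where
  "Vh \<Omega> Xh Qh = {v\<in>Xh. \<forall>q\<in>Qh. (LINT x:\<Omega>|lebesgue. divg \<Omega> v x * q x) = 0}"

definition aa_w :: "(int \<Rightarrow> 'a \<Rightarrow> 'b::real_vector) \<Rightarrow> (int \<Rightarrow> 'a \<Rightarrow> 'b) \<Rightarrow> int \<Rightarrow> 'a \<Rightarrow> 'b" where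
  "aa_w ut u j = (\<lambda>x. ut j x - u (j - 1) x)"

definition aa_e :: "(int \<Rightarrow> 'a \<Rightarrow> 'b::real_vector) \<Rightarrow> int \<Rightarrow> 'a \<Rightarrow> 'b" where
  "aa_e u j = (\<lambda>x. u j x - u (j - 1) x)"

end

theory Submission
  imports Defs
begin

text \<open>All norms \<open>|.|\<close> below are gradient norms. Let \<open>r = \<alpha>(k) w(k) + \<alpha>(k-1) w(k-1)\<close>. Subtracting the
  \<open>\<alpha>\<close>-combination of two consecutive Picard equations from the next one and testing with \<open>W = w(k+1)\<close>,
  skew-symmetry of \<open>b*\<close> leaves \<open>\<nu> |W|\<^sup>2 = - b*(r, g, W) - \<alpha>(k) b*(e(k), g' - g, W)\<close>, where \<open>g\<close> and \<open>g'\<close> are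
  the two Picard updates and \<open>|g' - g| \<le> \<kappa> |e(k-1)|\<close>. The Holder inequality with exponents 2, 3, 6 and the
  interpolated \<open>L\<^sup>3\<close> bound estimate the first term by the geometric mean of the \<open>L\<^sup>2\<close> and gradient norms
  of \<open>r\<close>, and the four quotients of the gain factor telescope to exactly this.

  Skew-symmetry on \<open>H10\<close> is the definition of the weak gradient of the transporting field, tested with
  products of test fields, followed by density. Since \<open>grad\<close> is an arbitrary choice of a weak gradient,
  its linearity needs almost everywhere uniqueness, hence smooth bump functions.\<close>

section \<open>Integral inequalities\<close>

text \<open>The interpolated L3 norm falls on the transporting slot of \<open>bstar\<close>, so the
  optimized residual is kept there and a Picard update goes into the gradient slot, where stability
  bounds it by the dual norm of f over nu. This yields the constant C3 C6 |f| / nu^2, which is kappa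
  without its factor sqrt CP; the CP in the last quotient of the gain factor compensates exactly. In
  the quadratic term, 1/nu comes from absorbing |W|, kappa from the Lipschitz bound, and K^2 from
  replacing both increments e(k) and e(k-1) by residuals. Two points shape the proof. Skew-symmetry
  turns \<open>bstar\<close> into half the difference of two convection integrals; this removes the
  divergence and with it a dimensional constant. And CP, C3, C6, K and the dual norm come without
  signs: the signs of CP, C3, C6 and the dual norm are derived from one field with nonzero gradient
  norm, and if no such field exists both sides of the claim are zero.\<close>

lemma Young_236:
  fixes a b c :: real
  assumes "a \<ge> 0" "b \<ge> 0" "c \<ge> 0"
  shows "a * b * c \<le> a\<^sup>2 / 2 + b ^ 3 / 3 + c ^ 6 / 6"
proof -
  have "0 \<le> (a - b * c)\<^sup>2" by simp
  then have 1: "a * b * c \<le> a\<^sup>2 / 2 + b\<^sup>2 * c\<^sup>2 / 2"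
    by (simp add: power2_eq_square algebra_simps)
  \<comment> \<open>AM-GM for \<open>b ^ 3\<close>, \<open>b ^ 3\<close>, \<open>c ^ 6\<close> as a
    factorization: the product expands to
    \<open>2 * b ^ 3 - 3 * b\<^sup>2 * c\<^sup>2 + c ^ 6\<close>.\<close>
  have "0 \<le> (b - c\<^sup>2)\<^sup>2 * (2 * b + c\<^sup>2)" using assms by simp
  then have "b\<^sup>2 * c\<^sup>2 \<le> 2 * b ^ 3 / 3 + c ^ 6 / 3"
    by (simp add: eval_nat_numeral algebra_simps)
  with 1 show ?thesis by simp
qed

lemma AE_zero_of_integral_power_zero:
  fixes f :: "'a \<Rightarrow> real"
  assumes "integrable M (\<lambda>x. \<bar>f x\<bar> ^ n)" "(\<integral>x. \<bar>f x\<bar> ^ n \<partial>M) = 0"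
  shows "AE x in M. f x = 0"
proof -
  have "AE x in M. \<bar>f x\<bar> ^ n = 0"
    using assms by (subst (asm) integral_nonneg_eq_0_iff_AE) auto
  then show ?thesis by (rule AE_mp) auto
qed

text \<open>Once each function is divided by its own norm, Young's inequality integrates to 1. A
  vanishing norm forbids the division but makes the integrand zero almost everywhere.\<close>

lemma Holder_236:
  fixes f g h :: "'a \<Rightarrow> real"
  assumes [measurable]: "f \<in> borel_measurable M" "g \<in> borel_measurable M" "h \<in> borel_measurable M"
    and f: "integrable M (\<lambda>x. (f x)\<^sup>2)" and g: "integrable M (\<lambda>x. \<bar>g x\<bar> ^ 3)"
    and h: "integrable M (\<lambda>x. \<bar>h x\<bar> ^ 6)"
  shows "integrable M (\<lambda>x. f x * g x * h x)" (is ?int)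
    and "(\<integral>x. \<bar>f x * g x * h x\<bar> \<partial>M) \<le> sqrt (\<integral>x. (f x)\<^sup>2 \<partial>M)
      * (\<integral>x. \<bar>g x\<bar> ^ 3 \<partial>M) powr (1/3) * (\<integral>x. \<bar>h x\<bar> ^ 6 \<partial>M) powr (1/6)" (is ?bound)
proof -
  have "integrable M (\<lambda>x. (f x)\<^sup>2 / 2 + \<bar>g x\<bar> ^ 3 / 3 + \<bar>h x\<bar> ^ 6 / 6)"
    using f g h by auto
  then show int: ?int
    by (rule Bochner_Integration.integrable_bound)
      (use Young_236[OF abs_ge_zero abs_ge_zero abs_ge_zero] in
        \<open>auto simp: abs_mult intro!: always_eventually abs_ge_self[THEN order_trans[rotated]]\<close>)
  define A where "A = (\<integral>x. (f x)\<^sup>2 \<partial>M)"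
  define B where "B = (\<integral>x. \<bar>g x\<bar> ^ 3 \<partial>M)"
  define C where "C = (\<integral>x. \<bar>h x\<bar> ^ 6 \<partial>M)"
  have nn: "A \<ge> 0" "B \<ge> 0" "C \<ge> 0" by (auto simp: A_def B_def C_def)
  show ?bound
  proof (cases "A = 0 \<or> B = 0 \<or> C = 0")
    case True
    have "AE x in M. f x * g x * h x = 0"
      using True
    proof (elim disjE)
      assume "A = 0"
      then have "AE x in M. f x = 0"
        using AE_zero_of_integral_power_zero[of M f 2] f by (simp add: A_def)
      then show ?thesis by (rule AE_mp) auto
    next
      assume "B = 0"
      then have "AE x in M. g x = 0"
        using AE_zero_of_integral_power_zero[of M g 3] g by (simp add: B_def)
      then show ?thesis by (rule AE_mp) auto
    next
      assume "C = 0"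
      then have "AE x in M. h x = 0"
        using AE_zero_of_integral_power_zero[of M h 6] h by (simp add: C_def)
      then show ?thesis by (rule AE_mp) auto
    qed
    then have "(\<integral>x. \<bar>f x * g x * h x\<bar> \<partial>M) = (\<integral>x. 0 \<partial>M)"
      by (intro integral_cong_AE) auto
    then show ?thesis by (simp add: nn)
  next
    case False
    with nn have pos: "A > 0" "B > 0" "C > 0" by auto
    define a where "a = sqrt A"
    define b where "b = B powr (1/3)"
    define c where "c = C powr (1/6)"
    have abc: "a > 0" "b > 0" "c > 0" using pos by (auto simp: a_def b_def c_def)
    have pw: "a\<^sup>2 = A" "b ^ 3 = B" "c ^ 6 = C"
      using pos by (auto simp: a_def b_def c_def powr_power)
    have "(\<integral>x. \<bar>f x * g x * h x\<bar> \<partial>M) / (a * b * c) = (\<integral>x. \<bar>f x * g x * h x\<bar> / (a * b * c) \<partial>M)"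
      by simp
    also have "\<dots> \<le> (\<integral>x. (f x)\<^sup>2 / A / 2 + \<bar>g x\<bar> ^ 3 / B / 3 + \<bar>h x\<bar> ^ 6 / C / 6 \<partial>M)"
    proof (rule integral_mono)
      show "integrable M (\<lambda>x. \<bar>f x * g x * h x\<bar> / (a * b * c))" using int by auto
      show "integrable M (\<lambda>x. (f x)\<^sup>2 / A / 2 + \<bar>g x\<bar> ^ 3 / B / 3 + \<bar>h x\<bar> ^ 6 / C / 6)"
        using f g h by auto
      fix x
      have "\<bar>f x\<bar> / a * (\<bar>g x\<bar> / b) * (\<bar>h x\<bar> / c)
          \<le> (\<bar>f x\<bar> / a)\<^sup>2 / 2 + (\<bar>g x\<bar> / b) ^ 3 / 3 + (\<bar>h x\<bar> / c) ^ 6 / 6"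
        by (rule Young_236) (use abc in auto)
      then show "\<bar>f x * g x * h x\<bar> / (a * b * c) \<le> (f x)\<^sup>2 / A / 2 + \<bar>g x\<bar> ^ 3 / B / 3 + \<bar>h x\<bar> ^ 6 / C / 6"
        by (simp add: power_divide pw abs_mult)
    qed
    also have "\<dots> = A / A / 2 + B / B / 3 + C / C / 6"
      using f g h by (simp add: A_def B_def C_def)
    also have "\<dots> = 1" using pos by simp
    finally show ?thesis using abc
      by (simp add: a_def b_def c_def A_def B_def C_def field_simps)
  qed
qed

lemma Cauchy_Schwarz_integral:
  fixes f g :: "'a \<Rightarrow> 'b::euclidean_space"
  assumes [measurable]: "f \<in> borel_measurable M" "g \<in> borel_measurable M"
    and f: "integrable M (\<lambda>x. (norm (f x))\<^sup>2)" and g: "integrable M (\<lambda>x. (norm (g x))\<^sup>2)"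
  shows "integrable M (\<lambda>x. f x \<bullet> g x)" (is ?int)
    and "\<bar>\<integral>x. f x \<bullet> g x \<partial>M\<bar> \<le> sqrt (\<integral>x. (norm (f x))\<^sup>2 \<partial>M) * sqrt (\<integral>x. (norm (g x))\<^sup>2 \<partial>M)"
proof -
  have young: "norm (f x) * norm (g x) \<le> ((norm (f x))\<^sup>2 + (norm (g x))\<^sup>2) / 2" for x
    using zero_le_power2[of "norm (f x) - norm (g x)"]
    unfolding power2_diff by simp
  have "integrable M (\<lambda>x. ((norm (f x))\<^sup>2 + (norm (g x))\<^sup>2) / 2)"
    using f g by auto
  then have intn: "integrable M (\<lambda>x. norm (f x) * norm (g x))"
    by (rule Bochner_Integration.integrable_bound) (use young in \<open>auto intro!: always_eventually\<close>)
  then show int: ?int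
    by (rule Bochner_Integration.integrable_bound)
      (auto intro!: always_eventually simp: Cauchy_Schwarz_ineq2)
  define A where "A = (\<integral>x. (norm (f x))\<^sup>2 \<partial>M)"
  define B where "B = (\<integral>x. (norm (g x))\<^sup>2 \<partial>M)"
  define I where "I = (\<integral>x. f x \<bullet> g x \<partial>M)"
  have nn: "A \<ge> 0" "B \<ge> 0" by (auto simp: A_def B_def)
  \<comment> \<open>The quadratic form of the discriminant argument, homogeneous in \<open>s\<close>
    and \<open>t\<close> so that both can be chosen without dividing by \<open>B\<close>.\<close>
  have q: "0 \<le> A * s\<^sup>2 - 2 * s * t * I + B * t\<^sup>2" for s t
  proof -
    have "0 \<le> (\<integral>x. (norm (s *\<^sub>R f x - t *\<^sub>R g x))\<^sup>2 \<partial>M)" by simp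
    also have "\<dots> = (\<integral>x. s\<^sup>2 * (norm (f x))\<^sup>2 - 2 * s * t * (f x \<bullet> g x) + t\<^sup>2 * (norm (g x))\<^sup>2 \<partial>M)"
    proof (intro Bochner_Integration.integral_cong refl)
      fix x
      have "(norm (s *\<^sub>R f x - t *\<^sub>R g x))\<^sup>2 = s * (s * (f x \<bullet> f x)) - 2 * (s * (t * (f x \<bullet> g x))) + t * (t * (g x \<bullet> g x))"
        by (simp add: power2_norm_eq_inner inner_diff_left inner_diff_right inner_commute)
      then show "(norm (s *\<^sub>R f x - t *\<^sub>R g x))\<^sup>2
          = s\<^sup>2 * (norm (f x))\<^sup>2 - 2 * s * t * (f x \<bullet> g x) + t\<^sup>2 * (norm (g x))\<^sup>2"
        by (simp add: power2_norm_eq_inner power2_eq_square[of s] power2_eq_square[of t] mult.assoc)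
    qed
    also have "\<dots> = A * s\<^sup>2 - 2 * s * t * I + B * t\<^sup>2"
      using f g int by (simp add: A_def B_def I_def)
    finally show ?thesis .
  qed
  have "I\<^sup>2 \<le> A * B"
  proof (cases "B = 0")
    case True
    have "I = 0"
    proof (rule ccontr)
      assume "I \<noteq> 0"
      then show False
        \<comment> \<open>With \<open>B = 0\<close> this choice makes the form equal to -1.\<close>
        using q[of 1 "(A + 1) / (2 * I)"] True by (simp add: field_simps)
    qed
    then show ?thesis using nn by simp
  next
    case False
    \<comment> \<open>Up to scaling, \<open>s = B\<close> and \<open>t = I\<close> minimize the form
      when \<open>B\<close> is positive.\<close>
    have "0 \<le> A * B\<^sup>2 - 2 * B * I * I + B * I\<^sup>2" by (rule q)
    also have "\<dots> = B * (A * B - I\<^sup>2)" by (simp add: power2_eq_square algebra_simps)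
    finally show ?thesis using False nn by (simp add: zero_le_mult_iff)
  qed
  then have "\<bar>I\<bar> \<le> sqrt (A * B)" by (simp add: real_le_rsqrt)
  then show "\<bar>\<integral>x. f x \<bullet> g x \<partial>M\<bar> \<le> sqrt (\<integral>x. (norm (f x))\<^sup>2 \<partial>M) * sqrt (\<integral>x. (norm (g x))\<^sup>2 \<partial>M)"
    by (simp add: A_def B_def I_def real_sqrt_mult)
qed

lemma integrable_norm_sq_add:
  fixes f g :: "'a \<Rightarrow> 'b::euclidean_space"
  assumes [measurable]: "f \<in> borel_measurable M" "g \<in> borel_measurable M"
    and f: "integrable M (\<lambda>x. (norm (f x))\<^sup>2)" and g: "integrable M (\<lambda>x. (norm (g x))\<^sup>2)"
  shows "integrable M (\<lambda>x. (norm (f x + g x))\<^sup>2)" (is ?int)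
    and "sqrt (\<integral>x. (norm (f x + g x))\<^sup>2 \<partial>M)
      \<le> sqrt (\<integral>x. (norm (f x))\<^sup>2 \<partial>M) + sqrt (\<integral>x. (norm (g x))\<^sup>2 \<partial>M)"
proof -
  note cs = Cauchy_Schwarz_integral[OF assms]
  have eq: "(norm (f x + g x))\<^sup>2 = (norm (f x))\<^sup>2 + 2 * (f x \<bullet> g x) + (norm (g x))\<^sup>2" for x
    by (simp add: power2_norm_eq_inner inner_add_left inner_add_right inner_commute)
  show ?int unfolding eq using f g cs(1) by auto
  have "(\<integral>x. (norm (f x + g x))\<^sup>2 \<partial>M)
      = (\<integral>x. (norm (f x))\<^sup>2 \<partial>M) + 2 * (\<integral>x. f x \<bullet> g x \<partial>M) + (\<integral>x. (norm (g x))\<^sup>2 \<partial>M)"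
    unfolding eq using f g cs(1) by simp
  also have "\<dots> \<le> (sqrt (\<integral>x. (norm (f x))\<^sup>2 \<partial>M) + sqrt (\<integral>x. (norm (g x))\<^sup>2 \<partial>M))\<^sup>2"
    using cs(2) by (simp add: power2_sum)
  finally show "sqrt (\<integral>x. (norm (f x + g x))\<^sup>2 \<partial>M)
      \<le> sqrt (\<integral>x. (norm (f x))\<^sup>2 \<partial>M) + sqrt (\<integral>x. (norm (g x))\<^sup>2 \<partial>M)"
    by (simp add: real_le_lsqrt)
qed

text \<open>Along an almost everywhere convergent subsequence, Fatou's lemma bounds the
  \<open>p\<close>-th power by \<open>B\<close>. The integrability is the point, since the Bochner
  integral of a non-integrable function says nothing.\<close>

lemma integrable_power_of_L2_limit:
  fixes f :: "'a \<Rightarrow> 'b::euclidean_space" and s :: "nat \<Rightarrow> 'a \<Rightarrow> 'b"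
  assumes [measurable]: "f \<in> borel_measurable M" "\<And>n. s n \<in> borel_measurable M"
    and int2: "\<And>n. integrable M (\<lambda>x. (norm (s n x - f x))\<^sup>2)"
    and lim: "(\<lambda>n. \<integral>x. (norm (s n x - f x))\<^sup>2 \<partial>M) \<longlonglongrightarrow> 0"
    and int: "\<And>n. integrable M (\<lambda>x. norm (s n x) ^ p)"
    and bnd: "\<And>n. (\<integral>x. norm (s n x) ^ p \<partial>M) \<le> B"
  shows "integrable M (\<lambda>x. norm (f x) ^ p)"
proof -
  obtain r where r: "strict_mono r" and ae: "AE x in M. (\<lambda>n. (norm (s (r n) x - f x))\<^sup>2) \<longlonglongrightarrow> 0"
    using tendsto_L1_AE_subseq[of M "\<lambda>n x. (norm (s n x - f x))\<^sup>2"] int2 lim by auto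
  have ae': "AE x in M. (\<lambda>n. ennreal (norm (s (r n) x) ^ p)) \<longlonglongrightarrow> ennreal (norm (f x) ^ p)"
    using ae
  proof (rule AE_mp, intro AE_I2 impI)
    fix x assume "(\<lambda>n. (norm (s (r n) x - f x))\<^sup>2) \<longlonglongrightarrow> 0"
    then have "(\<lambda>n. sqrt ((norm (s (r n) x - f x))\<^sup>2)) \<longlonglongrightarrow> sqrt 0" by (intro tendsto_intros)
    then have "(\<lambda>n. s (r n) x - f x) \<longlonglongrightarrow> 0" by (simp add: tendsto_norm_zero_iff)
    then have "(\<lambda>n. s (r n) x) \<longlonglongrightarrow> f x" by (simp add: LIM_zero_iff)
    then show "(\<lambda>n. ennreal (norm (s (r n) x) ^ p)) \<longlonglongrightarrow> ennreal (norm (f x) ^ p)"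
      by (intro tendsto_intros tendsto_ennrealI)
  qed
  have "(\<integral>\<^sup>+x. ennreal (norm (f x) ^ p) \<partial>M) = (\<integral>\<^sup>+x. liminf (\<lambda>n. ennreal (norm (s (r n) x) ^ p)) \<partial>M)"
  proof (rule nn_integral_cong_AE)
    show "AE x in M. ennreal (norm (f x) ^ p) = liminf (\<lambda>n. ennreal (norm (s (r n) x) ^ p))"
      using ae' by (rule AE_mp) (auto intro!: AE_I2 lim_imp_Liminf[symmetric])
  qed
  also have "\<dots> \<le> liminf (\<lambda>n. \<integral>\<^sup>+x. ennreal (norm (s (r n) x) ^ p) \<partial>M)"
    by (rule nn_integral_liminf) auto
  also have "\<dots> \<le> liminf (\<lambda>n::nat. ennreal B)"
    by (intro Liminf_mono always_eventually allI)
      (use int bnd in \<open>auto simp: nn_integral_eq_integral intro!: ennreal_leI\<close>)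
  also have "\<dots> = ennreal B" by (simp add: Liminf_const)
  finally have "(\<integral>\<^sup>+x. ennreal (norm (f x) ^ p) \<partial>M) < \<infinity>"
    using ennreal_less_top le_less_trans by (metis infinity_ennreal_def)
  then show ?thesis
    by (intro integrableI_bounded) (auto simp: norm_power)
qed

section \<open>Smooth functions and test functions\<close>

lemma partial_at_eqI:
  assumes "((\<lambda>t. f (x + t *\<^sub>R axis i 1)) has_real_derivative D) (at 0)"
  shows "partial_at i f x = D"
  unfolding partial_at_def using assms by (rule some_equality) (rule DERIV_unique[OF _ assms])

lemma has_real_derivative_partial_at:
  fixes f :: "real^'d::finite \<Rightarrow> real"
  assumes "f differentiable (at x)"
  shows "((\<lambda>t. f (x + t *\<^sub>R axis i 1)) has_real_derivative partial_at i f x) (at 0)"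
proof -
  obtain f' where f': "(f has_derivative f') (at x)" using assms by (auto simp: differentiable_def)
  have "((\<lambda>t. f (x + t *\<^sub>R axis i 1)) has_derivative (\<lambda>t. f' (0 + t *\<^sub>R axis i 1))) (at 0)"
    by (rule has_derivative_compose[where g=f])
      (use f' in \<open>auto intro!: derivative_eq_intros\<close>)
  moreover have "(\<lambda>t. f' (0 + t *\<^sub>R axis i 1)) = (*) (f' (axis i 1))"
    using has_derivative_linear[OF f'] by (auto simp: linear_scale)
  ultimately have "((\<lambda>t. f (x + t *\<^sub>R axis i 1)) has_real_derivative f' (axis i 1)) (at 0)"
    by (simp add: has_field_derivative_def)
  then show ?thesis using partial_at_eqI by metis
qed

text \<open>The derivative at every parameter of the line, not only at 0, as the mean value theorem
  requires.\<close>

lemma has_real_derivative_partial_at_line: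
  fixes f :: "real^'d::finite \<Rightarrow> real"
  assumes "f differentiable_on UNIV"
  shows "((\<lambda>t. f (x + t *\<^sub>R axis i 1)) has_real_derivative partial_at i f (x + s *\<^sub>R axis i 1)) (at s)"
proof -
  have "((\<lambda>t. f ((x + s *\<^sub>R axis i 1) + t *\<^sub>R axis i 1))
      has_real_derivative partial_at i f (x + s *\<^sub>R axis i 1)) (at (s - s))"
    using has_real_derivative_partial_at[of f] assms by (simp add: differentiable_on_def)
  moreover have "((\<lambda>t. t - s) has_real_derivative 1) (at s)"
    by (auto intro!: derivative_eq_intros)
  ultimately have "((\<lambda>t. f ((x + s *\<^sub>R axis i 1) + (t - s) *\<^sub>R axis i 1))
      has_real_derivative partial_at i f (x + s *\<^sub>R axis i 1) * 1) (at s)"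
    by (rule DERIV_chain2)
  then show ?thesis by (simp add: algebra_simps)
qed

lemma partial_at_const [simp]: "partial_at i (\<lambda>x. c) = (\<lambda>x. 0)"
  by (rule ext, rule partial_at_eqI) auto

lemma partial_at_add:
  assumes "f differentiable (at x)" "g differentiable (at x)"
  shows "partial_at i (\<lambda>x. f x + g x) x = partial_at i f x + partial_at i g x"
  by (rule partial_at_eqI) (intro derivative_intros has_real_derivative_partial_at assms)

lemma partial_at_sum:
  assumes "\<And>j. j \<in> J \<Longrightarrow> f j differentiable (at x)"
  shows "partial_at i (\<lambda>x. \<Sum>j\<in>J. f j x) x = (\<Sum>j\<in>J. partial_at i (f j) x)"
  by (rule partial_at_eqI) (intro DERIV_sum has_real_derivative_partial_at assms)

lemma partial_at_mult:
  assumes "f differentiable (at x)" "g differentiable (at x)"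
  shows "partial_at i (\<lambda>x. f x * g x) x = partial_at i f x * g x + f x * partial_at i g x"
  by (rule partial_at_eqI)
    (use DERIV_mult[OF has_real_derivative_partial_at[OF assms(1)] has_real_derivative_partial_at[OF assms(2)], of i i]
      in \<open>simp add: algebra_simps\<close>)

text \<open>Iterated partial derivatives never leave \<open>S\<close>, so a class closed under
  differentiation certifies smoothness without a formula for the higher derivatives.\<close>

lemma smooth_fun_coinduct:
  assumes "f \<in> S" and "\<And>g. g \<in> S \<Longrightarrow> g differentiable_on UNIV"
    and "\<And>g i. g \<in> S \<Longrightarrow> partial_at i g \<in> S"
  shows "smooth_fun f"
proof -
  have "iterpart is f \<in> S" for "is" by (induction "is") (use assms in auto)
  then show ?thesis using assms(2) by (auto simp: smooth_fun_def)
qed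

lemma smooth_fun_differentiable: "smooth_fun f \<Longrightarrow> f differentiable_on UNIV"
  unfolding smooth_fun_def by (metis iterpart.simps(1))

lemma smooth_fun_differentiable_at: "smooth_fun f \<Longrightarrow> f differentiable (at x)"
  using smooth_fun_differentiable by (auto simp: differentiable_on_def)

lemma smooth_fun_partial_at:
  assumes "smooth_fun f" shows "smooth_fun (partial_at i f)"
proof -
  \<comment> \<open>The recursion applies the head of the list last, so the innermost derivative
    sits at its end.\<close>
  have "iterpart is (partial_at i f) = iterpart (is @ [i]) f" for "is"
    by (induction "is") auto
  then show ?thesis using assms by (auto simp: smooth_fun_def)
qed

lemma smooth_fun_continuous_on: "smooth_fun f \<Longrightarrow> continuous_on S f"
  using smooth_fun_differentiable differentiable_imp_continuous_on continuous_on_subset by blast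

text \<open>The functions \<open>bump_term n\<close> are closed under differentiation up to sums and multiples;
  \<open>bump_term 0\<close> is the usual smooth cut-off \<open>exp (- 1 / t)\<close>.\<close>

definition bump_term :: "nat \<Rightarrow> real \<Rightarrow> real" where
  "bump_term n t = (if t > 0 then exp (- 1 / t) / t ^ n else 0)"

lemma bump_term_tendsto_0: "(bump_term n \<longlongrightarrow> 0) (at 0)"
proof -
  have "((\<lambda>t::real. exp (- 1 / t) / t ^ n) \<longlongrightarrow> 0) (at_right 0)"
  proof -
    \<comment> \<open>The substitution \<open>y = 1 / t\<close> turns the decay at 0 into the
      exponential dominating powers at infinity.\<close>
    have "((\<lambda>y::real. y ^ n / exp y) \<longlongrightarrow> 0) at_top" by (rule tendsto_power_div_exp_0)
    then have "((\<lambda>t::real. inverse t ^ n / exp (inverse t)) \<longlongrightarrow> 0) (at_right 0)"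
      by (rule filterlim_compose) (rule filterlim_inverse_at_top_right)
    then show ?thesis by (simp add: exp_minus field_simps)
  qed
  moreover have "eventually (\<lambda>t. exp (- 1 / t) / t ^ n = bump_term n t) (at_right 0)"
    by (auto simp: bump_term_def eventually_at_right_less intro: eventually_mono[OF eventually_at_right_less])
  ultimately have "(bump_term n \<longlongrightarrow> 0) (at_right 0)" by (rule Lim_transform_eventually)
  moreover have "(bump_term n \<longlongrightarrow> 0) (at_left 0)"
    by (rule Lim_transform_eventually[OF tendsto_const])
      (auto simp: bump_term_def eventually_at_left_field intro!: exI[of _ "-1"])
  ultimately show ?thesis by (simp add: filterlim_split_at)
qed

lemma bump_term_deriv:
  "(bump_term n has_real_derivative (bump_term (n + 2) t - real n * bump_term (n + 1) t)) (at t)"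
proof -
  consider "t > 0" | "t < 0" | "t = 0" by linarith
  then show ?thesis
  proof cases
    case 1
    have "((\<lambda>t. exp (- 1 / t)) has_real_derivative exp (- 1 / t) * (1 / t\<^sup>2)) (at t)"
      using 1 by (auto intro!: derivative_eq_intros simp: power2_eq_square)
    from DERIV_divide[OF this DERIV_pow[of n t]] 1
    have d: "((\<lambda>t. exp (- 1 / t) / t ^ n) has_real_derivative
        (exp (- 1 / t) * (1 / t\<^sup>2) * t ^ n - exp (- 1 / t) * (real n * t ^ (n - 1))) / (t ^ n * t ^ n)) (at t)"
      by simp
    have *: "((\<lambda>t. exp (- 1 / t) / t ^ n) has_real_derivative
        (bump_term (n + 2) t - real n * bump_term (n + 1) t)) (at t)"
      by (rule DERIV_cong[OF d])
        (use 1 in \<open>cases n; simp add: bump_term_def field_simps power2_eq_square\<close>)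
    show ?thesis
      by (rule has_field_derivative_transform_within_open[OF *, of "{0<..}"])
        (use 1 in \<open>auto simp: bump_term_def\<close>)
  next
    case 2
    show ?thesis
      by (rule has_field_derivative_transform_within_open[of "\<lambda>_. 0" _ _ "{..<0}"])
        (use 2 in \<open>auto simp: bump_term_def\<close>)
  next
    case 3
    \<comment> \<open>The difference quotient at 0 is \<open>bump_term (n + 1)\<close>.\<close>
    have "((\<lambda>h. (bump_term n h) / h) \<longlongrightarrow> 0) (at 0)"
      using bump_term_tendsto_0[of "n + 1"]
      by (rule Lim_transform_eventually) (auto simp: bump_term_def fun_eq_iff field_simps intro!: always_eventually)
    then show ?thesis using 3 by (simp add: DERIV_def bump_term_def)
  qed
qed

text \<open>A witness for coinduction: every element turns out to be smooth.\<close>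

inductive_set smooth_algebra :: "(real^'d::finite \<Rightarrow> real) set" where
  smooth: "smooth_fun f \<Longrightarrow> f \<in> smooth_algebra"
| const: "(\<lambda>x. c) \<in> smooth_algebra"
| bump: "(\<lambda>x. bump_term n (a * x $ i + b)) \<in> smooth_algebra"
| add: "f \<in> smooth_algebra \<Longrightarrow> g \<in> smooth_algebra \<Longrightarrow> (\<lambda>x. f x + g x) \<in> smooth_algebra"
| mult: "f \<in> smooth_algebra \<Longrightarrow> g \<in> smooth_algebra \<Longrightarrow> (\<lambda>x. f x * g x) \<in> smooth_algebra"

text \<open>Written with sums and constant multiples, not with a subtraction, so that the
  introduction rules of \<open>smooth_algebra\<close> match it.\<close>

lemma bump_partial_at:
  fixes i j :: "'d::finite"
  shows "partial_at j (\<lambda>x. bump_term n (a * x $ i + b)) =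
    (\<lambda>x. (if i = j then a else 0) * (bump_term (n + 2) (a * x $ i + b)
      + (- real n) * bump_term (n + 1) (a * x $ i + b)))"
proof (rule ext, rule partial_at_eqI)
  fix x :: "real^'d"
  have "((\<lambda>t. a * (x + t *\<^sub>R axis j 1) $ i + b) has_real_derivative (if i = j then a else 0)) (at 0)"
    by (auto intro!: derivative_eq_intros simp: axis_def)
  then show "((\<lambda>t. bump_term n (a * (x + t *\<^sub>R axis j 1) $ i + b)) has_real_derivative
      (if i = j then a else 0) * (bump_term (n + 2) (a * x $ i + b)
      + (- real n) * bump_term (n + 1) (a * x $ i + b))) (at 0)"
    by (rule DERIV_chain2[OF bump_term_deriv, THEN DERIV_cong]) (simp add: axis_def)
qed

lemma smooth_algebra_differentiable:
  fixes f :: "real^'d::finite \<Rightarrow> real"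
  shows "f \<in> smooth_algebra \<Longrightarrow> f differentiable_on UNIV"
proof (induction rule: smooth_algebra.induct)
  case (bump n a i b)
  have 1: "bump_term n differentiable (at t)" for t
    using bump_term_deriv[of n t] by (metis real_differentiable_def)
  show ?case
    unfolding differentiable_on_def
  proof
    fix x :: "real^'d"
    have "(\<lambda>x. a * x $ i + b) differentiable (at x)"
      by (auto simp: differentiable_def intro!: derivative_eq_intros exI bounded_linear_imp_has_derivative bounded_linear_vec_nth)
    from differentiable_chain_at[OF this 1]
    show "(\<lambda>x. bump_term n (a * x $ i + b)) differentiable (at x)" by (simp add: o_def)
  qed
qed (auto simp: smooth_fun_differentiable intro!: derivative_intros)

lemma smooth_algebra_partial_at: "f \<in> smooth_algebra \<Longrightarrow> partial_at i f \<in> smooth_algebra"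
proof (induction rule: smooth_algebra.induct)
  case (bump n a i b)
  then show ?case unfolding bump_partial_at by (intro smooth_algebra.intros)
next
  case (add f g)
  have "partial_at i (\<lambda>x. f x + g x) = (\<lambda>x. partial_at i f x + partial_at i g x)"
    using add.hyps smooth_algebra_differentiable
    by (intro ext partial_at_add) (auto simp: differentiable_on_def)
  then show ?case using add by (simp add: smooth_algebra.intros)
next
  case (mult f g)
  have "partial_at i (\<lambda>x. f x * g x) = (\<lambda>x. partial_at i f x * g x + f x * partial_at i g x)"
    using mult.hyps smooth_algebra_differentiable
    by (intro ext partial_at_mult) (auto simp: differentiable_on_def)
  then show ?case using mult by (simp add: smooth_algebra.intros)
qed (auto intro!: smooth_algebra.intros smooth_fun_partial_at)

text \<open>Coinduction collapses the auxiliary class to the smooth functions, so its introduction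
  rules become closure properties of smoothness.\<close>

lemma smooth_algebra_eq: "f \<in> smooth_algebra \<longleftrightarrow> smooth_fun f"
  using smooth_fun_coinduct[of f smooth_algebra] smooth_algebra_differentiable
    smooth_algebra_partial_at smooth_algebra.smooth by blast

lemma smooth_fun_const: "smooth_fun (\<lambda>x. c)"
  using smooth_algebra.const by (simp add: smooth_algebra_eq)

lemma smooth_fun_bump: "smooth_fun (\<lambda>x. bump_term n (a * x $ i + b))"
  using smooth_algebra.bump by (simp add: smooth_algebra_eq)

lemma smooth_fun_add: "smooth_fun f \<Longrightarrow> smooth_fun g \<Longrightarrow> smooth_fun (\<lambda>x. f x + g x)"
  using smooth_algebra.add by (simp add: smooth_algebra_eq)

lemma smooth_fun_mult: "smooth_fun f \<Longrightarrow> smooth_fun g \<Longrightarrow> smooth_fun (\<lambda>x. f x * g x)"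
  using smooth_algebra.mult by (simp add: smooth_algebra_eq)

lemma smooth_fun_prod:
  "finite J \<Longrightarrow> (\<And>j. j \<in> J \<Longrightarrow> smooth_fun (f j)) \<Longrightarrow> smooth_fun (\<lambda>x. \<Prod>j\<in>J. f j x)"
  by (induction J rule: finite_induct) (auto intro: smooth_fun_const smooth_fun_mult)

section \<open>Test functions: supports, closure properties, bounds\<close>

lemma test_fun_smooth: "test_fun \<Omega> f \<Longrightarrow> smooth_fun f"
  by (simp add: test_fun_def)

text \<open>Any compact set containing the nonzero points certifies the support, so closures never
  have to be computed.\<close>

lemma test_funI:
  assumes "smooth_fun f" "compact C" "C \<subseteq> \<Omega>" "\<And>x. f x \<noteq> 0 \<Longrightarrow> x \<in> C"
  shows "test_fun \<Omega> f"
proof -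
  have "closure {x. f x \<noteq> 0} \<subseteq> C"
    using assms by (intro closure_minimal) (auto simp: compact_imp_closed)
  moreover from this have "compact (closure {x. f x \<noteq> 0})"
    using compact_Int_closed[OF assms(2) closed_closure, of "{x. f x \<noteq> 0}"] by (simp add: Int_absorb1)
  ultimately show ?thesis using assms unfolding test_fun_def by auto
qed

lemma test_fun_support:
  "test_fun \<Omega> f \<Longrightarrow> \<exists>C. compact C \<and> C \<subseteq> \<Omega> \<and> (\<forall>x. f x \<noteq> 0 \<longrightarrow> x \<in> C)"
  by (rule exI[of _ "closure {x. f x \<noteq> 0}"]) (simp add: test_fun_def closure_subset[THEN subsetD])

lemma test_fun_mult:
  assumes "test_fun \<Omega> f" "smooth_fun g" shows "test_fun \<Omega> (\<lambda>x. f x * g x)"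
proof -
  obtain C where C: "compact C" "C \<subseteq> \<Omega>" "\<And>x. f x \<noteq> 0 \<Longrightarrow> x \<in> C"
    using test_fun_support[OF assms(1)] by blast
  have "smooth_fun (\<lambda>x. f x * g x)" by (intro smooth_fun_mult test_fun_smooth[OF assms(1)] assms(2))
  then show ?thesis by (rule test_funI[OF _ C(1,2)]) (use C(3) in simp)
qed

lemma test_fun_mult_const: "test_fun \<Omega> f \<Longrightarrow> test_fun \<Omega> (\<lambda>x. c * f x)"
  using test_fun_mult[OF _ smooth_fun_const, of \<Omega> f c] by (simp add: mult.commute)

lemma test_fun_add:
  assumes "test_fun \<Omega> f" "test_fun \<Omega> g" shows "test_fun \<Omega> (\<lambda>x. f x + g x)"
proof -
  obtain C where C: "compact C" "C \<subseteq> \<Omega>" "\<And>x. f x \<noteq> 0 \<Longrightarrow> x \<in> C" using test_fun_support[OF assms(1)] by blast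
  obtain D where D: "compact D" "D \<subseteq> \<Omega>" "\<And>x. g x \<noteq> 0 \<Longrightarrow> x \<in> D" using test_fun_support[OF assms(2)] by blast
  have "smooth_fun (\<lambda>x. f x + g x)" by (intro smooth_fun_add test_fun_smooth[OF assms(1)] test_fun_smooth[OF assms(2)])
  then show ?thesis
  proof (rule test_funI[of _ "C \<union> D"])
    show "x \<in> C \<union> D" if "f x + g x \<noteq> 0" for x using that C(3)[of x] D(3)[of x] by (cases "f x = 0") auto
  qed (use C D in auto)
qed

lemma test_fun_zero: "test_fun \<Omega> (\<lambda>x. 0)"
  by (rule test_funI[of _ "{}"]) (auto intro: smooth_fun_const)

lemma test_fun_sum:
  "(\<And>j. j \<in> J \<Longrightarrow> test_fun \<Omega> (f j)) \<Longrightarrow> test_fun \<Omega> (\<lambda>x. \<Sum>j\<in>J. f j x)"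
  by (induction J rule: infinite_finite_induct) (auto intro: test_fun_zero test_fun_add)

text \<open>Around a point off \<open>C\<close>, the function vanishes on an open piece of each
  coordinate line.\<close>

lemma partial_at_eq_0:
  assumes "closed C" "\<And>x. f x \<noteq> 0 \<Longrightarrow> x \<in> C" "x \<notin> C"
  shows "partial_at i f x = 0"
proof (rule partial_at_eqI)
  have "open ((\<lambda>t. x + t *\<^sub>R axis i 1) -` (- C))"
    using assms(1) by (intro open_vimage) (auto intro!: continuous_intros)
  then show "((\<lambda>t. f (x + t *\<^sub>R axis i 1)) has_real_derivative 0) (at 0)"
    by (rule has_field_derivative_transform_within_open[of "\<lambda>_. 0" 0 0, rotated])
      (use assms in auto)
qed

lemma test_fun_partial_at:
  assumes "test_fun \<Omega> f" shows "test_fun \<Omega> (partial_at i f)"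
proof -
  obtain C where C: "compact C" "C \<subseteq> \<Omega>" "\<And>x. f x \<noteq> 0 \<Longrightarrow> x \<in> C"
    using test_fun_support[OF assms] by blast
  show ?thesis
    by (rule test_funI[OF smooth_fun_partial_at[OF test_fun_smooth[OF assms]] C(1,2)])
      (use partial_at_eq_0[OF compact_imp_closed[OF C(1)] C(3)] in blast)
qed

lemma test_fun_bounded:
  assumes "test_fun \<Omega> f" obtains B where "\<And>x. \<bar>f x\<bar> \<le> B" "B \<ge> 0"
proof -
  obtain C where C: "compact C" "C \<subseteq> \<Omega>" "\<And>x. f x \<noteq> 0 \<Longrightarrow> x \<in> C"
    using test_fun_support[OF assms] by blast
  have "compact (f ` C)"
    using C(1) by (intro compact_continuous_image smooth_fun_continuous_on test_fun_smooth[OF assms])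
  then obtain B where B: "\<And>y. y \<in> f ` C \<Longrightarrow> norm y \<le> B"
    using compact_imp_bounded bounded_iff by metis
  have "\<bar>f x\<bar> \<le> max B 0" for x using B[of "f x"] C(3)[of x] by (cases "f x = 0") auto
  then show ?thesis using that[of "max B 0"] by auto
qed

lemma test_fun_bound_support:
  assumes "test_fun \<Omega> f"
  obtains B C where "compact C" "C \<subseteq> \<Omega>" "B \<ge> 0" "\<And>x. \<bar>f x\<bar> \<le> B * indicator C x"
proof -
  obtain B where B: "\<And>x. \<bar>f x\<bar> \<le> B" "B \<ge> 0" using test_fun_bounded[OF assms] by blast
  obtain C where C: "compact C" "C \<subseteq> \<Omega>" "\<And>x. f x \<noteq> 0 \<Longrightarrow> x \<in> C" using test_fun_support[OF assms] by blast
  show ?thesis by (rule that[OF C(1,2) B(2)]) (use B C in \<open>auto simp: indicator_def\<close>)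
qed

section \<open>The fundamental lemma of the calculus of variations\<close>

text \<open>The Borel sets over which \<open>F\<close> integrates to zero form a Dynkin system
  containing the intersection-stable open boxes, hence all Borel sets; then \<open>F\<close> and 0
  are densities with equal integrals.\<close>

lemma integral_box_zero_imp_AE_zero_lborel:
  fixes F :: "'a::euclidean_space \<Rightarrow> real"
  assumes F: "integrable lborel F"
    and box: "\<And>a b. (\<integral>x. indicator (box a b) x * F x \<partial>lborel) = 0"
  shows "AE x in lborel. F x = 0"
proof -
  have int: "integrable lborel (\<lambda>x. indicator A x * F x)" if "A \<in> sets borel" for A
    using integrable_mult_indicator[of A lborel F] F that by simp
  \<comment> \<open>Complements need the integral over the whole space, which an exhaustion by
    growing boxes supplies.\<close>
  have UNIV: "(\<integral>x. F x \<partial>lborel) = 0"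
  proof -
    have "(\<lambda>n::nat. \<integral>x. indicator (box (- real n *\<^sub>R One) (real n *\<^sub>R One)) x * F x \<partial>lborel)
        \<longlonglongrightarrow> (\<integral>x. F x \<partial>lborel)"
    proof (rule integral_dominated_convergence[where w="\<lambda>x. \<bar>F x\<bar>"])
      show "AE x in lborel. (\<lambda>n::nat. indicator (box (- real n *\<^sub>R One) (real n *\<^sub>R One)) x * F x) \<longlonglongrightarrow> F x"
      proof (rule AE_I2)
        fix x :: 'a
        obtain N :: nat where N: "norm x < real N" using reals_Archimedean2 by blast
        have "eventually (\<lambda>n. indicator (box (- real n *\<^sub>R One) (real n *\<^sub>R One)) x * F x = F x) sequentially"
          using eventually_ge_at_top[of N]
        proof eventually_elim
          case (elim n)
          have "x \<in> box (- real n *\<^sub>R One) (real n *\<^sub>R One)"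
            unfolding mem_box
          proof
            fix i :: 'a assume "i \<in> Basis"
            then have "\<bar>x \<bullet> i\<bar> < real n" using Basis_le_norm[of i x] N elim by linarith
            then show "- real n *\<^sub>R One \<bullet> i < x \<bullet> i \<and> x \<bullet> i < real n *\<^sub>R One \<bullet> i"
              using \<open>i \<in> Basis\<close> by auto
          qed
          then show ?case by simp
        qed
        then show "(\<lambda>n::nat. indicator (box (- real n *\<^sub>R One) (real n *\<^sub>R One)) x * F x) \<longlonglongrightarrow> F x"
          by (rule tendsto_eventually)
      qed
    qed (use F in \<open>auto simp: indicator_def\<close>)
    then show ?thesis unfolding box by (simp add: LIMSEQ_const_iff)
  qed
  have eq0: "(\<integral>x. indicator A x * F x \<partial>lborel) = 0" if "A \<in> sets borel" for A
  proof -
    have stable: "Int_stable (range (\<lambda>(a, b). box a b :: 'a set))"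
      by (auto simp: Int_stable_def box_Int_box)
    have "A \<in> sigma_sets UNIV (range (\<lambda>(a, b). box a b :: 'a set))"
      using that unfolding borel_eq_box by (simp add: sets_measure_of_conv)
    moreover have sub: "range (\<lambda>(a, b). box a b :: 'a set) \<subseteq> Pow UNIV" by simp
    ultimately show ?thesis
    proof (induction rule: sigma_sets_induct_disjoint[OF stable sub, consumes 1, case_names basic empty compl union])
      case (compl A)
      have A: "A \<in> sets borel" using compl.hyps unfolding borel_eq_box by (simp add: sets_measure_of_conv)
      have "(\<integral>x. indicator (UNIV - A) x * F x \<partial>lborel) = (\<integral>x. F x - indicator A x * F x \<partial>lborel)"
        by (intro Bochner_Integration.integral_cong) (auto simp: indicator_def)
      then show ?case using UNIV compl.IH F int[OF A] by simp
    next
      case (union A)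
      have A: "A i \<in> sets borel" for i
        using union.hyps unfolding borel_eq_box by (auto simp: sets_measure_of_conv)
      have "set_lebesgue_integral lborel (\<Union>i. A i) F = (\<Sum>i. set_lebesgue_integral lborel (A i) F)"
        by (rule lebesgue_integral_countable_add)
          (use A union.hyps int[of "\<Union>i. A i"] in \<open>auto simp: disjoint_family_on_def set_integrable_def\<close>)
      then show ?case using union.IH by (simp add: set_lebesgue_integral_def)
    qed (use box in auto)
  qed
  show ?thesis
    by (rule density_unique_real[of lborel F "\<lambda>_. 0"])
      (use F eq0 in \<open>auto simp: set_lebesgue_integral_def\<close>)
qed

text \<open>Boxes generate only the Borel sets, so the argument runs on a Borel representative
  \<open>G\<close> and is carried back to the completed measure.\<close>

lemma integral_box_zero_imp_AE_zero:
  fixes F :: "'a::euclidean_space \<Rightarrow> real"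
  assumes F: "integrable lebesgue F"
    and box: "\<And>a b. (\<integral>x. indicator (box a b) x * F x \<partial>lebesgue) = 0"
  shows "AE x in lebesgue. F x = 0"
proof -
  obtain G where G: "G \<in> borel_measurable lborel" "AE x in lborel. F x = G x"
    using completion_ex_borel_measurable_real[of F lborel] F by auto
  have ae: "AE x in lebesgue. F x = G x" using G(2) by (rule AE_completion)
  have "integrable lebesgue G"
    by (rule integrable_cong_AE_imp[OF F _ ae]) (use G(1) in \<open>simp add: measurable_completion\<close>)
  then have G': "integrable lborel G" using G(1) by (simp add: integrable_completion)
  have "AE x in lborel. G x = 0"
  proof (rule integral_box_zero_imp_AE_zero_lborel[OF G'])
    fix a b :: 'a
    have [measurable]: "F \<in> borel_measurable lebesgue" "G \<in> borel_measurable lebesgue"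
      using F G(1) by (auto simp: measurable_completion)
    have "(\<integral>x. indicator (box a b) x * G x \<partial>lborel) = (\<integral>x. indicator (box a b) x * G x \<partial>lebesgue)"
      using G(1) by (simp add: integral_completion)
    also have "\<dots> = (\<integral>x. indicator (box a b) x * F x \<partial>lebesgue)"
      by (intro integral_cong_AE borel_measurable_times borel_measurable_indicator) (use ae in auto)
    finally show "(\<integral>x. indicator (box a b) x * G x \<partial>lborel) = 0" using box by simp
  qed
  then have "AE x in lebesgue. G x = 0" by (rule AE_completion)
  with ae show ?thesis by eventually_elim simp
qed

text \<open>A product of one-sided cut-offs at the faces of the box, with \<open>r\<close> as
  steepness: for \<open>r > 0\<close> it is nonzero exactly on the open box, and it tends to the
  indicator as \<open>r\<close> grows. Each argument is a multiple plus a shift, to match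
  \<open>smooth_fun_bump\<close>.\<close>

definition box_bump :: "real \<Rightarrow> real^'d::finite \<Rightarrow> real^'d \<Rightarrow> real^'d \<Rightarrow> real" where
  "box_bump r a b x = (\<Prod>i\<in>UNIV. bump_term 0 (r * x $ i + (- r * a $ i)) * bump_term 0 ((- r) * x $ i + r * b $ i))"

lemma bump_term_0_bounds: "0 \<le> bump_term 0 t" "bump_term 0 t \<le> 1" "bump_term 0 t > 0 \<longleftrightarrow> t > 0"
  "bump_term 0 t = 0 \<longleftrightarrow> t \<le> 0"
  by (auto simp: bump_term_def)

lemma smooth_fun_box_bump: "smooth_fun (box_bump r a b)"
  unfolding box_bump_def by (intro smooth_fun_prod smooth_fun_mult smooth_fun_bump) auto

lemma box_bump_bounds: "0 \<le> box_bump r a b x" "box_bump r a b x \<le> 1"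
  unfolding box_bump_def
  by (auto intro!: prod_nonneg prod_le_1 mult_nonneg_nonneg mult_le_one simp: bump_term_0_bounds)

lemma box_bump_eq_0_iff:
  assumes "r > 0" shows "box_bump r a b x = 0 \<longleftrightarrow> x \<notin> box a b"
proof -
  have "r * x $ i + (- r * a $ i) \<le> 0 \<longleftrightarrow> x $ i \<le> a $ i" "(- r) * x $ i + r * b $ i \<le> 0 \<longleftrightarrow> b $ i \<le> x $ i" for i
    using assms by (simp_all add: algebra_simps)
  then show ?thesis
    by (auto simp: box_bump_def bump_term_0_bounds mem_box_cart not_less)
qed

lemma test_fun_box_bump:
  assumes "r > 0" "cbox a b \<subseteq> \<Omega>" shows "test_fun \<Omega> (box_bump r a b)"
  by (rule test_funI[OF smooth_fun_box_bump compact_cbox assms(2)])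
    (use assms(1) box_subset_cbox in \<open>auto simp: box_bump_eq_0_iff\<close>)

lemma box_bump_tendsto:
  "(\<lambda>n. box_bump (real (Suc n)) a b x) \<longlonglongrightarrow> indicator (box a b) x"
proof (cases "x \<in> box a b")
  case False
  then have "box_bump (real (Suc n)) a b x = 0" for n by (subst box_bump_eq_0_iff) auto
  then show ?thesis using False by simp
next
  case True
  have lim: "(\<lambda>n. bump_term 0 (real (Suc n) * s)) \<longlonglongrightarrow> 1" if "s > 0" for s
  proof -
    have "(\<lambda>n. exp (- (1 / s) * (1 / real (Suc n)))) \<longlonglongrightarrow> exp (- (1 / s) * 0)"
      by (intro tendsto_intros LIMSEQ_Suc[OF lim_1_over_n])
    moreover have "bump_term 0 (real (Suc n) * s) = exp (- (1 / s) * (1 / real (Suc n)))" for n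
      using that by (simp add: bump_term_def mult.commute del: of_nat_Suc)
    ultimately show ?thesis by simp
  qed
  have eq: "box_bump r a b x = (\<Prod>i\<in>UNIV. bump_term 0 (r * (x $ i - a $ i)) * bump_term 0 (r * (b $ i - x $ i)))" for r
    by (simp add: box_bump_def algebra_simps)
  have "(\<lambda>n. box_bump (real (Suc n)) a b x) \<longlonglongrightarrow> (\<Prod>i\<in>(UNIV::'a set). 1 * 1)"
    unfolding eq by (intro tendsto_intros lim) (use True in \<open>auto simp: mem_box_cart\<close>)
  then show ?thesis using True by simp
qed

lemma set_integrable_lebesgue_on:
  fixes f :: "'a::euclidean_space \<Rightarrow> 'b::euclidean_space"
  assumes "S \<in> sets lebesgue"
  shows "set_integrable lebesgue S f \<longleftrightarrow> integrable (lebesgue_on S) f"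
  using integrable_restrict_space[of S lebesgue f] assms by (simp add: set_integrable_def)

lemma set_integral_lebesgue_on:
  fixes f :: "'a::euclidean_space \<Rightarrow> 'b::euclidean_space"
  assumes "S \<in> sets lebesgue"
  shows "set_lebesgue_integral lebesgue S f = integral\<^sup>L (lebesgue_on S) f"
  using integral_restrict_space[of S lebesgue f] assms by (simp add: set_lebesgue_integral_def)

lemma integral_lebesgue_on_supported:
  fixes f :: "'a::euclidean_space \<Rightarrow> real"
  assumes "S \<in> sets lebesgue" "\<And>x. x \<notin> S \<Longrightarrow> f x = 0"
  shows "integrable (lebesgue_on S) f \<longleftrightarrow> integrable lebesgue f"
    and "integral\<^sup>L (lebesgue_on S) f = integral\<^sup>L lebesgue f"
proof -
  have eq: "(\<lambda>x. indicator S x *\<^sub>R f x) = f" using assms(2) by (auto simp: indicator_def fun_eq_iff)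
  show "integrable (lebesgue_on S) f \<longleftrightarrow> integrable lebesgue f"
    using integrable_restrict_space[of S lebesgue f] assms(1) unfolding eq by simp
  show "integral\<^sup>L (lebesgue_on S) f = integral\<^sup>L lebesgue f"
    using integral_restrict_space[of S lebesgue f] assms(1) unfolding eq by simp
qed

text \<open>Integrability is given only for products of \<open>H\<close> with test functions. A
  fixed cut-off \<open>\<phi>\<close> first makes \<open>F = H * \<phi>\<close> integrable on the
  whole space; ever steeper bumps show that \<open>F\<close> integrates to zero over every box, and
  \<open>\<phi>\<close> is divided out where it is nonzero.\<close>

lemma fundamental_lemma_variations:
  fixes H :: "real^'d::finite \<Rightarrow> real"
  assumes "open \<Omega>"
    and int: "\<And>\<phi>. test_fun \<Omega> \<phi> \<Longrightarrow> integrable (lebesgue_on \<Omega>) (\<lambda>x. H x * \<phi> x)"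
    and zero: "\<And>\<phi>. test_fun \<Omega> \<phi> \<Longrightarrow> (\<integral>x. H x * \<phi> x \<partial>lebesgue_on \<Omega>) = 0"
  shows "AE x in lebesgue_on \<Omega>. H x = 0"
proof -
  have \<Omega>: "\<Omega> \<in> sets lebesgue" using assms(1) by auto
  have box: "AE x in lebesgue. x \<in> box a b \<longrightarrow> H x = 0" if ab: "cbox a b \<subseteq> \<Omega>" for a b
  proof -
    define \<phi> where "\<phi> = box_bump 1 a b"
    have \<phi>: "test_fun \<Omega> \<phi>" unfolding \<phi>_def using ab by (intro test_fun_box_bump) auto
    have supp: "\<phi> x = 0" if "x \<notin> box a b" for x using that by (simp add: \<phi>_def box_bump_eq_0_iff)
    have \<phi>_nz: "\<phi> x \<noteq> 0" if "x \<in> box a b" for x using that by (simp add: \<phi>_def box_bump_eq_0_iff)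
    have sub: "box a b \<subseteq> \<Omega>" using ab box_subset_cbox by blast
    define F where "F x = H x * \<phi> x" for x
    have F0: "F x = 0" if "x \<notin> \<Omega>" for x using that sub supp by (auto simp: F_def)
    have F: "integrable lebesgue F"
      using int[OF \<phi>] integral_lebesgue_on_supported(1)[OF \<Omega> F0] unfolding F_def by simp
    have "AE x in lebesgue. F x = 0"
    proof (rule integral_box_zero_imp_AE_zero[OF F])
      fix c d :: "real^'d"
      have z: "(\<integral>x. box_bump (real (Suc n)) c d x * F x \<partial>lebesgue) = 0" for n
      proof -
        have "(\<integral>x. box_bump (real (Suc n)) c d x * F x \<partial>lebesgue)
            = (\<integral>x. box_bump (real (Suc n)) c d x * F x \<partial>lebesgue_on \<Omega>)"
          by (rule integral_lebesgue_on_supported(2)[symmetric]) (use \<Omega> F0 in auto)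
        also have "\<dots> = (\<integral>x. H x * (\<phi> x * box_bump (real (Suc n)) c d x) \<partial>lebesgue_on \<Omega>)"
          by (simp add: F_def mult_ac)
        \<comment> \<open>The factor \<open>\<phi>\<close> keeps the support inside
          \<open>\<Omega>\<close> even when the box from \<open>c\<close> to \<open>d\<close> leaves
          it.\<close>
        also have "\<dots> = 0"
          by (rule zero) (intro test_fun_mult \<phi> smooth_fun_box_bump)
        finally show ?thesis .
      qed
      have "(\<lambda>n. \<integral>x. box_bump (real (Suc n)) c d x * F x \<partial>lebesgue)
          \<longlonglongrightarrow> (\<integral>x. indicator (box c d) x * F x \<partial>lebesgue)"
      proof (rule integral_dominated_convergence[where w="\<lambda>x. \<bar>F x\<bar>"])
        show "AE x in lebesgue. (\<lambda>n. box_bump (real (Suc n)) c d x * F x) \<longlonglongrightarrow> indicator (box c d) x * F x"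
          by (intro AE_I2 tendsto_intros box_bump_tendsto)
        show "AE x in lebesgue. norm (box_bump (real (Suc n)) c d x * F x) \<le> \<bar>F x\<bar>" for n
          by (intro AE_I2) (simp add: abs_mult abs_of_nonneg[OF box_bump_bounds(1)] mult_left_le_one_le
            box_bump_bounds del: of_nat_Suc)
        have "box_bump (real (Suc n)) c d \<in> borel_measurable borel" for n
          by (intro borel_measurable_continuous_onI smooth_fun_continuous_on smooth_fun_box_bump)
        then have "box_bump (real (Suc n)) c d \<in> borel_measurable lebesgue" for n
          by (intro measurable_completion) simp
        then show "(\<lambda>x. box_bump (real (Suc n)) c d x * F x) \<in> borel_measurable lebesgue" for n
          using F by auto
        show "(\<lambda>x. indicator (box c d) x * F x) \<in> borel_measurable lebesgue"
          using F by (intro borel_measurable_times borel_measurable_indicator) auto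
      qed (use F in auto)
      then show "(\<integral>x. indicator (box c d) x * F x \<partial>lebesgue) = 0"
        unfolding z by (simp add: LIMSEQ_const_iff)
    qed
    then show ?thesis by (rule AE_mp) (auto intro!: AE_I2 simp: F_def \<phi>_nz)
  qed
  obtain \<D> where \<D>: "countable \<D>" "\<D> \<subseteq> Pow \<Omega>" "\<And>X. X \<in> \<D> \<Longrightarrow> \<exists>a b. X = cbox a b" "\<Union>\<D> = \<Omega>"
    using open_countable_Union_open_cbox[OF assms(1)] by metis
  have "AE x in lebesgue. x \<in> X \<longrightarrow> H x = 0" if X: "X \<in> \<D>" for X
  proof -
    obtain a b where ab: "X = cbox a b" using \<D>(3)[OF X] by auto
    have "AE x in lebesgue. x \<in> box a b \<longrightarrow> H x = 0"
      using box[of a b] \<D>(2) X ab by auto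
    \<comment> \<open>The covering consists of closed boxes, but \<open>\<phi>\<close> is nonzero
      only on the open ones; the faces are null sets.\<close>
    moreover have "negligible (cbox a b - box a b)" by (rule negligible_frontier_interval)
    then have "AE x in lebesgue. x \<notin> cbox a b - box a b"
      by (intro AE_not_in) (simp add: negligible_iff_null_sets)
    ultimately show ?thesis by eventually_elim (auto simp: ab)
  qed
  then have "AE x in lebesgue. \<forall>X\<in>\<D>. x \<in> X \<longrightarrow> H x = 0"
    using \<D>(1) by (subst AE_ball_countable) blast+
  then have "AE x in lebesgue. x \<in> \<Omega> \<longrightarrow> H x = 0"
    by eventually_elim (use \<D>(4) in auto)
  then show ?thesis using \<Omega> by (simp add: AE_restrict_space_iff)
qed

section \<open>Integration by parts for test functions\<close>

lemma test_fun_measurable: "test_fun \<Omega> f \<Longrightarrow> f \<in> borel_measurable borel"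
  by (intro borel_measurable_continuous_onI smooth_fun_continuous_on test_fun_smooth)

lemma test_fun_measurable_lebesgue_on:
  assumes "test_fun \<Omega> f" shows "f \<in> borel_measurable (lebesgue_on S)"
proof -
  have "f \<in> borel_measurable lebesgue"
    using test_fun_measurable[OF assms] by (intro measurable_completion) simp
  then show ?thesis by (rule measurable_restrict_space1)
qed

lemma integrable_lborel_bounded_support:
  fixes f :: "'a::euclidean_space \<Rightarrow> real"
  assumes "f \<in> borel_measurable borel" "compact C" "\<And>x. \<bar>f x\<bar> \<le> B * indicator C x"
  shows "integrable lborel f"
proof -
  have "integrable lborel (\<lambda>x. indicator C x :: real)"
    using assms(2) by (intro integrable_real_indicator) (auto simp: compact_imp_closed emeasure_bounded_finite[OF compact_imp_bounded, simplified])
  then have "integrable lborel (\<lambda>x. B * indicator C x)" by auto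
  then show ?thesis
    by (rule Bochner_Integration.integrable_bound)
      (use assms(1,3) in \<open>auto intro!: AE_I2 order_trans[OF _ abs_ge_self]\<close>)
qed

lemma test_fun_integrable_lborel: "test_fun \<Omega> f \<Longrightarrow> integrable lborel f"
  using test_fun_bound_support[of \<Omega> f] integrable_lborel_bounded_support test_fun_measurable
  by metis

text \<open>The difference quotients of a test function have integral zero by translation invariance.\<close>

lemma integral_partial_at_test_fun:
  fixes f :: "real^'d::finite \<Rightarrow> real"
  assumes f: "test_fun \<Omega> f"
  shows "(\<integral>x. partial_at l f x \<partial>lborel) = 0"
proof -
  define e :: "real^'d" where "e = axis l 1"
  define h where "h n = 1 / real (Suc n)" for n
  have h: "h n > 0" "h n \<le> 1" for n by (auto simp: h_def)
  define q where "q n x = (f (h n *\<^sub>R e + x) - f x) / h n" for n x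
  have f_meas [measurable]: "f \<in> borel_measurable borel" by (rule test_fun_measurable[OF f])
  obtain B where B: "\<And>x. \<bar>partial_at l f x\<bar> \<le> B" "B \<ge> 0"
    using test_fun_bounded[OF test_fun_partial_at[OF f]] by metis
  obtain C where C: "compact C" "\<And>x. f x \<noteq> 0 \<Longrightarrow> x \<in> C"
    using test_fun_support[OF f] by blast
  obtain R where R: "\<And>x. x \<in> C \<Longrightarrow> norm x \<le> R"
    using compact_imp_bounded[OF C(1)] bounded_iff by metis
  have ne: "norm e = 1" by (simp add: e_def)
  \<comment> \<open>Steps of length at most 1 keep all difference quotients supported in the ball of
    radius \<open>R + 1\<close>, and the mean value theorem bounds them by \<open>B\<close>. This is
    the dominating function for the limit.\<close>
  have q_bnd: "\<bar>q n x\<bar> \<le> B * indicator (cball 0 (R + 1)) x" for n x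
  proof (cases "x \<in> cball 0 (R + 1)")
    case True
    have "\<exists>z. 0 < z \<and> z < h n \<and> f (x + h n *\<^sub>R e) - f (x + 0 *\<^sub>R e) = (h n - 0) * partial_at l f (x + z *\<^sub>R e)"
      unfolding e_def
      by (rule MVT2[where f="\<lambda>t. f (x + t *\<^sub>R axis l 1)"])
        (use h has_real_derivative_partial_at_line[OF smooth_fun_differentiable[OF test_fun_smooth[OF f]]] in auto)
    then obtain z where "f (x + h n *\<^sub>R e) - f x = h n * partial_at l f (x + z *\<^sub>R e)" by auto
    then have "q n x = partial_at l f (x + z *\<^sub>R e)"
      using h[of n] by (simp add: q_def add.commute)
    then show ?thesis using B True by simp
  next
    case False
    then have n: "norm x > R + 1" by simp
    have "f x = 0" using R[of x] C(2)[of x] n by fastforce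
    moreover have "norm (h n *\<^sub>R e + x) > R"
      using norm_triangle_ineq4[of "h n *\<^sub>R e + x" "h n *\<^sub>R e"] n h[of n] ne by simp
    then have "f (h n *\<^sub>R e + x) = 0" using R C(2) by force
    ultimately show ?thesis using B(2) by (simp add: q_def)
  qed
  have int_f: "integrable lborel f" by (rule test_fun_integrable_lborel[OF f])
  have int_fs: "integrable lborel (\<lambda>x. f (c + x))" "(\<integral>x. f (c + x) \<partial>lborel) = (\<integral>x. f x \<partial>lborel)" for c
  proof -
    have d: "distr lborel borel ((+) c) = lborel" by (rule lborel_distr_plus)
    show "integrable lborel (\<lambda>x. f (c + x))"
      using int_f integrable_distr_eq[of "(+) c" lborel borel f] by (simp add: d)
    show "(\<integral>x. f (c + x) \<partial>lborel) = (\<integral>x. f x \<partial>lborel)"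
      using integral_distr[of "(+) c" lborel borel f] by (simp add: d)
  qed
  have "(\<lambda>n. \<integral>x. q n x \<partial>lborel) \<longlonglongrightarrow> (\<integral>x. partial_at l f x \<partial>lborel)"
  proof (rule integral_dominated_convergence[where w="\<lambda>x. B * indicator (cball 0 (R + 1)) x"])
    show "integrable lborel (\<lambda>x. B * indicator (cball 0 (R + 1)) x :: real)"
      by (intro integrable_mult_right integrable_real_indicator) (use emeasure_bounded_finite[OF bounded_cball] in auto)
    show "AE x in lborel. (\<lambda>n. q n x) \<longlonglongrightarrow> partial_at l f x"
    proof (rule AE_I2)
      fix x
      have "((\<lambda>t. (f (x + t *\<^sub>R e) - f x) / t) \<longlongrightarrow> partial_at l f x) (at 0)"
        using has_real_derivative_partial_at[OF smooth_fun_differentiable_at[OF test_fun_smooth[OF f]], of x l]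
        by (simp add: DERIV_def e_def)
      moreover have "h \<longlonglongrightarrow> 0" unfolding h_def by (rule LIMSEQ_Suc[OF lim_1_over_n])
      then have "filterlim h (at 0) sequentially"
        unfolding filterlim_at using h by (auto simp: less_imp_neq[symmetric])
      ultimately have "((\<lambda>n. (f (x + h n *\<^sub>R e) - f x) / h n) \<longlongrightarrow> partial_at l f x) sequentially"
        by (rule filterlim_compose)
      then show "(\<lambda>n. q n x) \<longlonglongrightarrow> partial_at l f x" by (simp add: q_def add.commute)
    qed
    show "partial_at l f \<in> borel_measurable lborel"
      using test_fun_measurable[OF test_fun_partial_at[OF f]] by simp
    show "q n \<in> borel_measurable lborel" for n unfolding q_def by measurable
  qed (use q_bnd in auto)
  moreover have "(\<integral>x. q n x \<partial>lborel) = 0" for n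
    unfolding q_def using int_f int_fs by simp
  ultimately show ?thesis by (simp add: LIMSEQ_const_iff)
qed

text \<open>Test functions are Borel and vanish off \<open>\<Omega>\<close>, so their integrals move
  to \<open>lborel\<close>, where translation invariance is available.\<close>

lemma test_fun_integrable:
  assumes "\<Omega> \<in> sets lebesgue" "test_fun \<Omega> f"
  shows "integrable (lebesgue_on \<Omega>) f" "integral\<^sup>L (lebesgue_on \<Omega>) f = integral\<^sup>L lborel f"
proof -
  have "f x = 0" if "x \<notin> \<Omega>" for x using that test_fun_support[OF assms(2)] by blast
  note * = integral_lebesgue_on_supported[OF assms(1) this]
  show "integrable (lebesgue_on \<Omega>) f"
    using * test_fun_integrable_lborel[OF assms(2)] test_fun_measurable[OF assms(2)]
    by (simp add: integrable_completion)
  show "integral\<^sup>L (lebesgue_on \<Omega>) f = integral\<^sup>L lborel f"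
    using * test_fun_measurable[OF assms(2)] by (simp add: integral_completion)
qed

lemma test_fun_integration_by_parts:
  assumes "\<Omega> \<in> sets lebesgue" "test_fun \<Omega> f" "test_fun \<Omega> g"
  shows "(\<integral>x. f x * partial_at l g x \<partial>lebesgue_on \<Omega>) = - (\<integral>x. partial_at l f x * g x \<partial>lebesgue_on \<Omega>)"
proof -
  note [simp] = test_fun_integrable(1)[OF assms(1)] test_fun_mult test_fun_partial_at assms test_fun_smooth[OF assms(2)]
     test_fun_smooth[OF assms(3)] smooth_fun_partial_at
  have "(\<integral>x. f x * partial_at l g x \<partial>lebesgue_on \<Omega>) + (\<integral>x. partial_at l f x * g x \<partial>lebesgue_on \<Omega>)
      = (\<integral>x. f x * partial_at l g x + partial_at l f x * g x \<partial>lebesgue_on \<Omega>)"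
    by (rule Bochner_Integration.integral_add[symmetric]) simp_all
  also have "(\<lambda>x. f x * partial_at l g x + partial_at l f x * g x) = partial_at l (\<lambda>x. f x * g x)"
    by (simp add: fun_eq_iff partial_at_mult smooth_fun_differentiable_at)
  also have "integral\<^sup>L (lebesgue_on \<Omega>) \<dots> = 0"
    using test_fun_integrable(2)[OF assms(1), of "partial_at l (\<lambda>x. f x * g x)"]
      integral_partial_at_test_fun[of \<Omega> "\<lambda>x. f x * g x" l] by simp
  finally show ?thesis by simp
qed

section \<open>Weak gradients\<close>

text \<open>Completeness of Lebesgue measure. The arbitrarily chosen \<open>grad\<close> is
  determined only up to null sets, so its measurability has to be inherited from another
  representative.\<close>

lemma borel_measurable_lebesgue_on_AE:
  fixes f g :: "'a::euclidean_space \<Rightarrow> 'b::euclidean_space"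
  assumes S: "S \<in> sets lebesgue" and f: "f \<in> borel_measurable (lebesgue_on S)"
    and ae: "AE x in lebesgue_on S. f x = g x"
  shows "g \<in> borel_measurable (lebesgue_on S)"
proof -
  have S': "S \<inter> space lebesgue \<in> sets lebesgue" using S by simp
  let ?f = "\<lambda>x. indicator S x *\<^sub>R f x" and ?g = "\<lambda>x. indicator S x *\<^sub>R g x"
  have f': "?f \<in> borel_measurable lebesgue"
    using f borel_measurable_restrict_space_iff[OF S', of f] by simp
  have ae': "AE x in lebesgue. ?f x = ?g x"
  proof -
    have "AE x in lebesgue. x \<in> S \<longrightarrow> f x = g x" using ae S by (simp add: AE_restrict_space_iff)
    then show ?thesis by eventually_elim (auto simp: indicator_def)
  qed
  have "?g \<in> borel_measurable lebesgue"
  proof (rule measurableI)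
    fix A :: "'b set" assume A: "A \<in> sets borel"
    have "?g -` A \<inter> space lebesgue \<in> sets lebesgue"
    proof (rule completion.in_sets_AE)
      show "AE x in lebesgue. x \<in> ?f -` A \<inter> space lebesgue \<longleftrightarrow> x \<in> ?g -` A \<inter> space lebesgue"
        using ae' by eventually_elim (simp only: vimage_eq Int_iff)
      show "?f -` A \<inter> space lebesgue \<in> sets lebesgue" by (rule measurable_sets[OF f' A])
    qed simp
    then show "?g -` A \<inter> space lebesgue \<in> sets lebesgue" .
  qed simp
  then show ?thesis using borel_measurable_restrict_space_iff[OF S', of g] by simp
qed

lemma borel_measurable_vec_nth:
  fixes f :: "'a \<Rightarrow> ('b::euclidean_space)^'n::finite"
  assumes "f \<in> borel_measurable M" shows "(\<lambda>x. f x $ i) \<in> borel_measurable M"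
  by (rule measurable_compose[OF assms]) (intro borel_measurable_continuous_onI continuous_intros)

lemma borel_measurable_vecI:
  fixes f :: "'a \<Rightarrow> ('b::euclidean_space)^'n::finite"
  assumes "\<And>i. (\<lambda>x. f x $ i) \<in> borel_measurable M" shows "f \<in> borel_measurable M"
proof (subst borel_measurable_euclidean_space, intro ballI)
  fix c :: "'b^'n" assume "c \<in> Basis"
  then obtain i b where c: "c = axis i b" by (auto simp: Basis_vec_def)
  have "(\<lambda>x. f x \<bullet> c) = (\<lambda>x. f x $ i \<bullet> b)" by (simp add: c inner_axis)
  then show "(\<lambda>x. f x \<bullet> c) \<in> borel_measurable M" using assms[of i] by simp
qed

section \<open>Square-integrable functions on an open domain\<close>

locale open_domain =
  fixes \<Omega> :: "(real^'d::finite) set"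
  assumes open_domain: "open \<Omega>"
begin

lemma sets_domain: "\<Omega> \<in> sets lebesgue"
  using open_domain by auto

lemmas set_integrable_domain = set_integrable_lebesgue_on[OF sets_domain]
  and set_integral_domain = set_integral_lebesgue_on[OF sets_domain]

lemma L2fun_iff:
  "L2fun \<Omega> f \<longleftrightarrow> f \<in> borel_measurable (lebesgue_on \<Omega>) \<and> integrable (lebesgue_on \<Omega>) (\<lambda>x. (norm (f x))\<^sup>2)"
  using borel_measurable_restrict_space_iff[of \<Omega> lebesgue f] sets_domain
  by (simp add: L2fun_def set_integrable_domain set_borel_measurable_def)

lemma L2n_eq: "L2n \<Omega> f = sqrt (\<integral>x. (norm (f x))\<^sup>2 \<partial>lebesgue_on \<Omega>)"
  by (simp add: L2n_def set_integral_domain)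

lemma L2n_nonneg [simp]: "0 \<le> L2n \<Omega> f"
  by (simp add: L2n_eq)

lemma L2fun_measurable: "L2fun \<Omega> f \<Longrightarrow> f \<in> borel_measurable (lebesgue_on \<Omega>)"
  by (simp add: L2fun_iff)

lemma L2fun_bound:
  assumes "L2fun \<Omega> f" "g \<in> borel_measurable (lebesgue_on \<Omega>)" "\<And>x. norm (g x) \<le> c * norm (f x)"
  shows "L2fun \<Omega> g"
proof -
  have "integrable (lebesgue_on \<Omega>) (\<lambda>x. c\<^sup>2 * (norm (f x))\<^sup>2)" using assms(1) by (simp add: L2fun_iff)
  moreover have "(\<lambda>x. (norm (g x))\<^sup>2) \<in> borel_measurable (lebesgue_on \<Omega>)"
    using assms(2) by measurable
  moreover have "AE x in lebesgue_on \<Omega>. norm ((norm (g x))\<^sup>2) \<le> norm (c\<^sup>2 * (norm (f x))\<^sup>2)"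
    using power_mono[OF assms(3) norm_ge_zero, of _ 2] by (intro AE_I2) (simp add: power_mult_distrib)
  ultimately have "integrable (lebesgue_on \<Omega>) (\<lambda>x. (norm (g x))\<^sup>2)"
    by (rule Bochner_Integration.integrable_bound)
  then show ?thesis using assms(2) by (simp add: L2fun_iff)
qed

lemma L2fun_nth:
  fixes f :: "real^'d \<Rightarrow> ('b::euclidean_space)^'n::finite"
  shows "L2fun \<Omega> f \<Longrightarrow> L2fun \<Omega> (\<lambda>x. f x $ i)"
  by (rule L2fun_bound[where c=1]) (auto simp: L2fun_measurable Finite_Cartesian_Product.norm_nth_le
      intro: borel_measurable_vec_nth)

lemma L2fun_add: "L2fun \<Omega> f \<Longrightarrow> L2fun \<Omega> g \<Longrightarrow> L2fun \<Omega> (\<lambda>x. f x + g x)"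
  using integrable_norm_sq_add(1)[of f "lebesgue_on \<Omega>" g]
  by (simp add: L2fun_iff borel_measurable_add)

lemma L2fun_scaleR: "L2fun \<Omega> f \<Longrightarrow> L2fun \<Omega> (\<lambda>x. a *\<^sub>R f x)"
  by (rule L2fun_bound[where c="\<bar>a\<bar>"]) (auto dest: L2fun_measurable)

lemma L2fun_lincomb: "L2fun \<Omega> f \<Longrightarrow> L2fun \<Omega> g \<Longrightarrow> L2fun \<Omega> (\<lambda>x. a *\<^sub>R f x + b *\<^sub>R g x)"
  by (intro L2fun_add L2fun_scaleR)

lemma L2fun_diff: "L2fun \<Omega> f \<Longrightarrow> L2fun \<Omega> g \<Longrightarrow> L2fun \<Omega> (\<lambda>x. f x - g x)"
  using L2fun_lincomb[of f g 1 "-1"] by simp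

lemma L2n_add_le: "L2fun \<Omega> f \<Longrightarrow> L2fun \<Omega> g \<Longrightarrow> L2n \<Omega> (\<lambda>x. f x + g x) \<le> L2n \<Omega> f + L2n \<Omega> g"
  using integrable_norm_sq_add(2)[of f "lebesgue_on \<Omega>" g] by (simp add: L2fun_iff L2n_eq)

lemma L2n_scaleR: "L2n \<Omega> (\<lambda>x. a *\<^sub>R f x) = \<bar>a\<bar> * L2n \<Omega> f"
  by (simp add: L2n_eq power_mult_distrib real_sqrt_mult)

lemma L2n_lincomb_le:
  "L2fun \<Omega> f \<Longrightarrow> L2fun \<Omega> g \<Longrightarrow> L2n \<Omega> (\<lambda>x. a *\<^sub>R f x + b *\<^sub>R g x) \<le> \<bar>a\<bar> * L2n \<Omega> f + \<bar>b\<bar> * L2n \<Omega> g"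
  using L2n_add_le[OF L2fun_scaleR L2fun_scaleR, of f g a b] by (simp add: L2n_scaleR)

lemma L2fun_AE_cong:
  assumes "L2fun \<Omega> f" "AE x in lebesgue_on \<Omega>. f x = g x" shows "L2fun \<Omega> g"
proof -
  have g: "g \<in> borel_measurable (lebesgue_on \<Omega>)"
    by (rule borel_measurable_lebesgue_on_AE[OF sets_domain L2fun_measurable[OF assms(1)] assms(2)])
  have "integrable (lebesgue_on \<Omega>) (\<lambda>x. (norm (f x))\<^sup>2)"
    using assms(1) by (simp add: L2fun_iff)
  moreover have "(\<lambda>x. (norm (g x))\<^sup>2) \<in> borel_measurable (lebesgue_on \<Omega>)"
    using g by measurable
  moreover have "AE x in lebesgue_on \<Omega>. (norm (f x))\<^sup>2 = (norm (g x))\<^sup>2"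
    using assms(2) by eventually_elim simp
  ultimately have "integrable (lebesgue_on \<Omega>) (\<lambda>x. (norm (g x))\<^sup>2)"
    by (rule integrable_cong_AE_imp)
  with g show ?thesis by (simp add: L2fun_iff)
qed

lemma L2n_AE_cong:
  assumes "L2fun \<Omega> f" "AE x in lebesgue_on \<Omega>. f x = g x" shows "L2n \<Omega> f = L2n \<Omega> g"
proof -
  have [measurable]: "f \<in> borel_measurable (lebesgue_on \<Omega>)" "g \<in> borel_measurable (lebesgue_on \<Omega>)"
    using assms L2fun_AE_cong L2fun_measurable by blast+
  have "AE x in lebesgue_on \<Omega>. (norm (f x))\<^sup>2 = (norm (g x))\<^sup>2"
    using assms(2) by eventually_elim simp
  then show ?thesis unfolding L2n_eq by (intro arg_cong[of _ _ sqrt] integral_cong_AE) auto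
qed

lemma L2n_eq_0_iff:
  assumes "L2fun \<Omega> f" shows "L2n \<Omega> f = 0 \<longleftrightarrow> (AE x in lebesgue_on \<Omega>. f x = 0)"
  using assms by (simp add: L2n_eq L2fun_iff integral_nonneg_eq_0_iff_AE)

lemma L2fun_inner_integrable: "L2fun \<Omega> f \<Longrightarrow> L2fun \<Omega> g \<Longrightarrow> integrable (lebesgue_on \<Omega>) (\<lambda>x. f x \<bullet> g x)"
  by (intro Cauchy_Schwarz_integral(1)) (simp_all add: L2fun_iff)

lemma L2fun_mult_integrable:
  fixes f g :: "real^'d \<Rightarrow> real"
  shows "L2fun \<Omega> f \<Longrightarrow> L2fun \<Omega> g \<Longrightarrow> integrable (lebesgue_on \<Omega>) (\<lambda>x. f x * g x)"
  using L2fun_inner_integrable[of f g] by (simp add: mult.commute)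

lemma test_fun_L2fun:
  assumes "test_fun \<Omega> f" shows "L2fun \<Omega> f"
  using test_fun_integrable(1)[OF sets_domain test_fun_mult[OF assms test_fun_smooth[OF assms]]]
    test_fun_measurable_lebesgue_on[OF assms]
  by (simp add: L2fun_iff power2_eq_square)

lemma L2fun_vecI:
  fixes f :: "real^'d \<Rightarrow> ('b::euclidean_space)^'n::finite"
  assumes "\<And>i. L2fun \<Omega> (\<lambda>x. f x $ i)" shows "L2fun \<Omega> f"
proof -
  have "(norm (f x))\<^sup>2 = (\<Sum>i\<in>UNIV. (norm (f x $ i))\<^sup>2)" for x
    by (simp add: norm_vec_def L2_set_def sum_nonneg)
  then show ?thesis using assms by (auto simp: L2fun_iff intro!: borel_measurable_vecI)
qed

section \<open>Uniqueness and linearity of weak gradients\<close>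

lemma weak_grad_iff:
  "weak_grad \<Omega> u G \<longleftrightarrow> (\<forall>\<phi> i l. test_fun \<Omega> \<phi> \<longrightarrow>
      integrable (lebesgue_on \<Omega>) (\<lambda>x. u x $ i * partial_at l \<phi> x)
    \<and> integrable (lebesgue_on \<Omega>) (\<lambda>x. G x $ i $ l * \<phi> x)
    \<and> (\<integral>x. u x $ i * partial_at l \<phi> x \<partial>lebesgue_on \<Omega>) = - (\<integral>x. G x $ i $ l * \<phi> x \<partial>lebesgue_on \<Omega>))"
  by (simp add: weak_grad_def set_integrable_domain set_integral_domain)

text \<open>Each entry of the difference is orthogonal to all test functions, and the finitely many
  exceptional null sets combine.\<close>

lemma weak_grad_unique:
  assumes "weak_grad \<Omega> u G" "weak_grad \<Omega> u G'"
  shows "AE x in lebesgue_on \<Omega>. G x = G' x"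
proof -
  have "AE x in lebesgue_on \<Omega>. G x $ i $ l - G' x $ i $ l = 0" for i l
    by (rule fundamental_lemma_variations[OF open_domain])
      (use assms in \<open>auto simp: weak_grad_iff left_diff_distrib\<close>)
  then have "AE x in lebesgue_on \<Omega>. \<forall>i l. G x $ i $ l - G' x $ i $ l = 0"
    by (simp add: AE_all_countable)
  then show ?thesis by eventually_elim (simp add: vec_eq_iff)
qed

lemma grad_AE_eq: "weak_grad \<Omega> u G \<Longrightarrow> AE x in lebesgue_on \<Omega>. grad \<Omega> u x = G x"
  unfolding grad_def by (rule weak_grad_unique[OF someI[where P="weak_grad \<Omega> u"]])

lemma weak_grad_lincomb:
  assumes "weak_grad \<Omega> u G" "weak_grad \<Omega> v H"
  shows "weak_grad \<Omega> (\<lambda>x. a *\<^sub>R u x + b *\<^sub>R v x) (\<lambda>x. a *\<^sub>R G x + b *\<^sub>R H x)"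
  using assms by (auto simp: weak_grad_iff distrib_right mult.assoc)

lemma test_field_L2fun: "(\<And>i. test_fun \<Omega> (\<lambda>x. \<phi> x $ i)) \<Longrightarrow> L2fun \<Omega> \<phi>"
  by (intro L2fun_vecI test_fun_L2fun)

lemma test_field_cgrad_L2fun: "(\<And>i. test_fun \<Omega> (\<lambda>x. \<phi> x $ i)) \<Longrightarrow> L2fun \<Omega> (cgrad \<phi>)"
  unfolding cgrad_def by (intro L2fun_vecI test_fun_L2fun) (simp add: test_fun_partial_at)

lemma test_field_weak_grad:
  assumes "\<And>i. test_fun \<Omega> (\<lambda>x. \<phi> x $ i)"
  shows "weak_grad \<Omega> \<phi> (cgrad \<phi>)"
  unfolding weak_grad_iff cgrad_def
  using assms test_fun_integration_by_parts[OF sets_domain]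
  by (auto intro!: L2fun_mult_integrable test_fun_L2fun test_fun_partial_at)

lemma test_field_lincomb:
  assumes "\<And>i. test_fun \<Omega> (\<lambda>x. \<phi> x $ i)" "\<And>i. test_fun \<Omega> (\<lambda>x. \<psi> x $ i)"
  shows "test_fun \<Omega> (\<lambda>x. (a *\<^sub>R \<phi> x + b *\<^sub>R \<psi> x) $ i)"
  using assms by (simp add: test_fun_add test_fun_mult_const)

lemma cgrad_lincomb:
  assumes "\<And>i. test_fun \<Omega> (\<lambda>x. \<phi> x $ i)" "\<And>i. test_fun \<Omega> (\<lambda>x. \<psi> x $ i)"
  shows "cgrad (\<lambda>x. a *\<^sub>R \<phi> x + b *\<^sub>R \<psi> x) x = a *\<^sub>R cgrad \<phi> x + b *\<^sub>R cgrad \<psi> x"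
proof -
  have d: "(\<lambda>x. \<phi> x $ i) differentiable (at x)" "(\<lambda>x. \<psi> x $ i) differentiable (at x)" for i
    using assms by (auto intro!: smooth_fun_differentiable_at test_fun_smooth)
  have "partial_at l (\<lambda>x. a * \<phi> x $ i + b * \<psi> x $ i) x
      = a * partial_at l (\<lambda>x. \<phi> x $ i) x + b * partial_at l (\<lambda>x. \<psi> x $ i) x" for i l
    using d by (simp add: partial_at_add partial_at_mult)
  then show ?thesis by (simp add: cgrad_def vec_eq_iff)
qed

section \<open>The space \<open>H10\<close>\<close>

lemma test_field_H10:
  assumes "\<And>i. test_fun \<Omega> (\<lambda>x. \<phi> x $ i)" shows "\<phi> \<in> H10 \<Omega>"
  unfolding H10_def
proof (intro CollectI conjI exI[of _ "cgrad \<phi>"] exI[of _ "\<lambda>n::nat. \<phi>"])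
  show "L2fun \<Omega> \<phi>" "weak_grad \<Omega> \<phi> (cgrad \<phi>)" "L2fun \<Omega> (cgrad \<phi>)"
    using assms by (auto intro: test_field_L2fun test_field_weak_grad test_field_cgrad_L2fun)
qed (use assms in \<open>auto simp: L2n_eq\<close>)

lemma H10_lincomb:
  assumes u: "u \<in> H10 \<Omega>" and v: "v \<in> H10 \<Omega>"
  shows "(\<lambda>x. a *\<^sub>R u x + b *\<^sub>R v x) \<in> H10 \<Omega>"
proof -
  obtain G \<phi> where G: "L2fun \<Omega> u" "weak_grad \<Omega> u G" "L2fun \<Omega> G" "\<And>n i. test_fun \<Omega> (\<lambda>x. \<phi> n x $ i)"
    "(\<lambda>n. L2n \<Omega> (\<lambda>x. \<phi> n x - u x)) \<longlonglongrightarrow> 0" "(\<lambda>n. L2n \<Omega> (\<lambda>x. cgrad (\<phi> n) x - G x)) \<longlonglongrightarrow> 0"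
    using u by (auto simp: H10_def)
  obtain H \<psi> where H: "L2fun \<Omega> v" "weak_grad \<Omega> v H" "L2fun \<Omega> H" "\<And>n i. test_fun \<Omega> (\<lambda>x. \<psi> n x $ i)"
    "(\<lambda>n. L2n \<Omega> (\<lambda>x. \<psi> n x - v x)) \<longlonglongrightarrow> 0" "(\<lambda>n. L2n \<Omega> (\<lambda>x. cgrad (\<psi> n) x - H x)) \<longlonglongrightarrow> 0"
    using v by (auto simp: H10_def)
  let ?\<eta> = "\<lambda>n x. a *\<^sub>R \<phi> n x + b *\<^sub>R \<psi> n x"
  \<comment> \<open>Stated for an arbitrary Euclidean value space so that it serves both the fields
    and their gradients.\<close>
  have lim: "(\<lambda>n. L2n \<Omega> (\<lambda>x. (a *\<^sub>R f n x + b *\<^sub>R g n x) - (a *\<^sub>R F x + b *\<^sub>R K x))) \<longlonglongrightarrow> 0"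
    if "\<And>n. L2fun \<Omega> (f n)" "\<And>n. L2fun \<Omega> (g n)" "L2fun \<Omega> F" "L2fun \<Omega> K"
      "(\<lambda>n. L2n \<Omega> (\<lambda>x. f n x - F x)) \<longlonglongrightarrow> 0" "(\<lambda>n. L2n \<Omega> (\<lambda>x. g n x - K x)) \<longlonglongrightarrow> 0"
    for f g :: "nat \<Rightarrow> real^'d \<Rightarrow> 'e::euclidean_space" and F K
  proof (rule tendsto_sandwich[OF _ _ tendsto_const])
    show "eventually (\<lambda>n. L2n \<Omega> (\<lambda>x. (a *\<^sub>R f n x + b *\<^sub>R g n x) - (a *\<^sub>R F x + b *\<^sub>R K x))
        \<le> \<bar>a\<bar> * L2n \<Omega> (\<lambda>x. f n x - F x) + \<bar>b\<bar> * L2n \<Omega> (\<lambda>x. g n x - K x)) sequentially"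
    proof (intro always_eventually allI)
      fix n
      show "L2n \<Omega> (\<lambda>x. (a *\<^sub>R f n x + b *\<^sub>R g n x) - (a *\<^sub>R F x + b *\<^sub>R K x))
        \<le> \<bar>a\<bar> * L2n \<Omega> (\<lambda>x. f n x - F x) + \<bar>b\<bar> * L2n \<Omega> (\<lambda>x. g n x - K x)"
        using L2n_lincomb_le[OF L2fun_diff[OF that(1,3), of n] L2fun_diff[OF that(2,4), of n], of a b]
        by (simp add: algebra_simps)
    qed
    show "(\<lambda>n. \<bar>a\<bar> * L2n \<Omega> (\<lambda>x. f n x - F x) + \<bar>b\<bar> * L2n \<Omega> (\<lambda>x. g n x - K x)) \<longlonglongrightarrow> 0"
      using that(5,6) by (intro tendsto_eq_intros) auto
  qed auto
  show ?thesis
    unfolding H10_def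
  proof (intro CollectI conjI exI[of _ "\<lambda>x. a *\<^sub>R G x + b *\<^sub>R H x"] exI[of _ ?\<eta>])
    show "\<forall>n i. test_fun \<Omega> (\<lambda>x. ?\<eta> n x $ i)" using G(4) H(4) test_field_lincomb by blast
    show "(\<lambda>n. L2n \<Omega> (\<lambda>x. ?\<eta> n x - (a *\<^sub>R u x + b *\<^sub>R v x))) \<longlonglongrightarrow> 0"
      by (rule lim) (use G H in \<open>auto intro: test_field_L2fun\<close>)
    show "(\<lambda>n. L2n \<Omega> (\<lambda>x. cgrad (?\<eta> n) x - (a *\<^sub>R G x + b *\<^sub>R H x))) \<longlonglongrightarrow> 0"
      unfolding cgrad_lincomb[OF G(4) H(4)]
      by (rule lim) (use G H in \<open>auto intro: test_field_cgrad_L2fun\<close>)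
  qed (use G H in \<open>auto intro: L2fun_lincomb weak_grad_lincomb\<close>)
qed

lemma H10_diff: "u \<in> H10 \<Omega> \<Longrightarrow> v \<in> H10 \<Omega> \<Longrightarrow> (\<lambda>x. u x - v x) \<in> H10 \<Omega>"
  using H10_lincomb[of u v 1 "-1"] by simp

lemma H10_weak_grad: "u \<in> H10 \<Omega> \<Longrightarrow> weak_grad \<Omega> u (grad \<Omega> u)"
  unfolding grad_def H10_def by (auto intro: someI[where P="weak_grad \<Omega> u"])

lemma H10_L2fun: "u \<in> H10 \<Omega> \<Longrightarrow> L2fun \<Omega> u"
  by (simp add: H10_def)

text \<open>\<open>grad\<close> is chosen among all weak gradients, square-integrable or not; by
  uniqueness it agrees almost everywhere with the square-integrable witness in
  \<open>H10\<close>.\<close>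

lemma H10_grad_L2fun:
  assumes "u \<in> H10 \<Omega>" shows "L2fun \<Omega> (grad \<Omega> u)"
proof -
  obtain G where G: "weak_grad \<Omega> u G" "L2fun \<Omega> G" using assms by (auto simp: H10_def)
  have "AE x in lebesgue_on \<Omega>. G x = grad \<Omega> u x" using grad_AE_eq[OF G(1)] by eventually_elim simp
  then show ?thesis by (rule L2fun_AE_cong[OF G(2)])
qed

lemma grad_lincomb:
  assumes "u \<in> H10 \<Omega>" "v \<in> H10 \<Omega>"
  shows "AE x in lebesgue_on \<Omega>. grad \<Omega> (\<lambda>x. a *\<^sub>R u x + b *\<^sub>R v x) x = a *\<^sub>R grad \<Omega> u x + b *\<^sub>R grad \<Omega> v x"
  by (rule grad_AE_eq) (intro weak_grad_lincomb H10_weak_grad assms)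

text \<open>The definition measures convergence against its own witness \<open>G\<close>; uniqueness
  turns this into convergence in \<open>h1n\<close>, the form that the density arguments
  use.\<close>

lemma H10_approx:
  assumes "u \<in> H10 \<Omega>"
  obtains \<phi> where "\<And>n i. test_fun \<Omega> (\<lambda>x. \<phi> n x $ i)" "\<And>n. \<phi> n \<in> H10 \<Omega>"
    "(\<lambda>n. L2n \<Omega> (\<lambda>x. \<phi> n x - u x)) \<longlonglongrightarrow> 0" "(\<lambda>n. h1n \<Omega> (\<lambda>x. \<phi> n x - u x)) \<longlonglongrightarrow> 0"
proof -
  obtain G \<phi> where G: "weak_grad \<Omega> u G" "L2fun \<Omega> G" "\<And>n i. test_fun \<Omega> (\<lambda>x. \<phi> n x $ i)"
    "(\<lambda>n. L2n \<Omega> (\<lambda>x. \<phi> n x - u x)) \<longlonglongrightarrow> 0" "(\<lambda>n. L2n \<Omega> (\<lambda>x. cgrad (\<phi> n) x - G x)) \<longlonglongrightarrow> 0"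
    using assms by (auto simp: H10_def)
  have "h1n \<Omega> (\<lambda>x. \<phi> n x - u x) = L2n \<Omega> (\<lambda>x. cgrad (\<phi> n) x - G x)" for n
  proof -
    have "AE x in lebesgue_on \<Omega>. cgrad (\<phi> n) x - G x = grad \<Omega> (\<lambda>x. \<phi> n x - u x) x"
      using grad_AE_eq[OF weak_grad_lincomb[OF test_field_weak_grad[of "\<phi> n", OF G(3)] G(1), of 1 "-1"]]
      by eventually_elim simp
    then show ?thesis unfolding h1n_def
      by (intro L2n_AE_cong[symmetric] L2fun_diff test_field_cgrad_L2fun G)
  qed
  then show ?thesis using that[of \<phi>] G test_field_H10 by simp
qed

end

section \<open>The trilinear form\<close>

text \<open>\<open>norm\<close> on matrices is the Frobenius norm, so Cauchy-Schwarz row by row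
  suffices.\<close>

lemma norm_matrix_vector_mult_le:
  fixes A :: "real^'n^'m"
  shows "norm (A *v x) \<le> norm A * norm x"
proof -
  have "norm (A *v x) = L2_set (\<lambda>i. norm (A $ i \<bullet> x)) UNIV"
    by (simp add: norm_vec_def matrix_mult_dot)
  also have "\<dots> \<le> L2_set (\<lambda>i. norm (A $ i) * norm x) UNIV"
    by (rule L2_set_mono) (auto simp: Cauchy_Schwarz_ineq2)
  also have "\<dots> = norm A * norm x"
    by (simp add: norm_vec_def[of A] L2_set_left_distrib)
  finally show ?thesis .
qed

context open_domain
begin

lemma Lpn_3_eq: "Lpn 3 \<Omega> u = (\<integral>x. norm (u x) ^ 3 \<partial>lebesgue_on \<Omega>) powr (1/3)"
  and Lpn_6_eq: "Lpn 6 \<Omega> u = (\<integral>x. norm (u x) ^ 6 \<partial>lebesgue_on \<Omega>) powr (1/6)"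
  by (simp_all add: Lpn_def set_integral_domain)

lemma Lpn_nonneg [simp]: "0 \<le> Lpn p \<Omega> u"
  by (simp add: Lpn_def)

lemma h1n_nonneg [simp]: "0 \<le> h1n \<Omega> u"
  by (simp add: h1n_def)

lemma h1n_lincomb_le:
  assumes "u \<in> H10 \<Omega>" "v \<in> H10 \<Omega>"
  shows "h1n \<Omega> (\<lambda>x. a *\<^sub>R u x + b *\<^sub>R v x) \<le> \<bar>a\<bar> * h1n \<Omega> u + \<bar>b\<bar> * h1n \<Omega> v"
  using L2n_AE_cong[OF H10_grad_L2fun[OF H10_lincomb[OF assms]] grad_lincomb[OF assms], of a b]
    L2n_lincomb_le[OF H10_grad_L2fun[OF assms(1)] H10_grad_L2fun[OF assms(2)], of a b]
  by (simp add: h1n_def)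

text \<open>The zero field is then a weak gradient of \<open>u\<close>. Read contrapositively, a
  nonzero gradient norm makes the L2 norm positive, which protects denominators and fixes the sign
  of \<open>CP\<close>.\<close>

lemma h1n_eq_0_of_L2n_eq_0:
  assumes "u \<in> H10 \<Omega>" "L2n \<Omega> u = 0" shows "h1n \<Omega> u = 0"
proof -
  have ae: "AE x in lebesgue_on \<Omega>. u x = 0"
    using assms L2n_eq_0_iff H10_L2fun by blast
  have "weak_grad \<Omega> u (\<lambda>x. 0)"
    unfolding weak_grad_iff
  proof (intro allI impI conjI)
    fix \<phi> i l assume \<phi>: "test_fun \<Omega> \<phi>"
    have z: "AE x in lebesgue_on \<Omega>. u x $ i * partial_at l \<phi> x = 0"
      using ae by eventually_elim simp
    show "integrable (lebesgue_on \<Omega>) (\<lambda>x. u x $ i * partial_at l \<phi> x)"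
      by (intro L2fun_mult_integrable L2fun_nth H10_L2fun test_fun_L2fun test_fun_partial_at assms \<phi>)
    show "(\<integral>x. u x $ i * partial_at l \<phi> x \<partial>lebesgue_on \<Omega>) = - (\<integral>x. 0 $ i $ l * \<phi> x \<partial>lebesgue_on \<Omega>)"
      using integral_eq_zero_AE[OF z] by simp
  qed simp
  then have "AE x in lebesgue_on \<Omega>. grad \<Omega> u x = 0" by (rule grad_AE_eq)
  then show ?thesis using L2n_eq_0_iff[OF H10_grad_L2fun[OF assms(1)]] by (simp add: h1n_def)
qed

lemma test_field_integrable_power:
  assumes "\<And>i. test_fun \<Omega> (\<lambda>x. \<phi> x $ i)" "2 \<le> p"
  shows "integrable (lebesgue_on \<Omega>) (\<lambda>x. norm (\<phi> x) ^ p)"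
proof -
  have "\<exists>B. \<forall>x. \<bar>\<phi> x $ i\<bar> \<le> B" for i
    using test_fun_bounded[OF assms(1)[of i]] by blast
  then obtain B where B: "\<And>i x. \<bar>\<phi> x $ i\<bar> \<le> B i" by metis
  define C where "C = (\<Sum>i\<in>UNIV. B i)"
  have C: "norm (\<phi> x) \<le> C" for x
    unfolding C_def using norm_le_l1_cart[of "\<phi> x"] sum_mono[of UNIV "\<lambda>i. \<bar>\<phi> x $ i\<bar>" B] B by fastforce
  have L2: "L2fun \<Omega> \<phi>" by (rule test_field_L2fun[OF assms(1)])
  \<comment> \<open>The bound \<open>C\<close> absorbs \<open>p - 2\<close> powers of the norm, and
    the remaining square is integrable.\<close>
  have "integrable (lebesgue_on \<Omega>) (\<lambda>x. C ^ (p - 2) * (norm (\<phi> x))\<^sup>2)"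
    using L2 by (simp add: L2fun_iff)
  moreover have "(\<lambda>x. norm (\<phi> x) ^ p) \<in> borel_measurable (lebesgue_on \<Omega>)"
    using L2fun_measurable[OF L2] by measurable
  moreover have "AE x in lebesgue_on \<Omega>. norm (norm (\<phi> x) ^ p) \<le> norm (C ^ (p - 2) * (norm (\<phi> x))\<^sup>2)"
  proof (rule AE_I2)
    fix x
    have "norm (\<phi> x) ^ p = norm (\<phi> x) ^ (p - 2) * (norm (\<phi> x))\<^sup>2"
      using assms(2) by (simp only: power_add[symmetric] le_add_diff_inverse2)
    also have "\<dots> \<le> C ^ (p - 2) * (norm (\<phi> x))\<^sup>2"
      by (intro mult_right_mono power_mono C) auto
    finally show "norm (norm (\<phi> x) ^ p) \<le> norm (C ^ (p - 2) * (norm (\<phi> x))\<^sup>2)"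
      by (simp add: abs_of_nonneg)
  qed
  ultimately show ?thesis by (rule Bochner_Integration.integrable_bound)
qed

text \<open>The crude dimensional factor is harmless: it serves integrability and the continuity
  behind the density argument, while the final estimates contain no divergence.\<close>

lemma divg_abs_le: "\<bar>divg \<Omega> v x\<bar> \<le> real CARD('d) * norm (grad \<Omega> v x)"
proof -
  have "\<bar>divg \<Omega> v x\<bar> \<le> (\<Sum>i\<in>(UNIV::'d set). norm (grad \<Omega> v x))"
    unfolding divg_def
    by (rule order_trans[OF sum_abs sum_mono])
      (metis Finite_Cartesian_Product.norm_nth_le order_trans real_norm_def)
  then show ?thesis by simp
qed

lemma divg_L2fun:
  assumes "v \<in> H10 \<Omega>" shows "L2fun \<Omega> (divg \<Omega> v)"
proof (rule L2fun_bound[OF H10_grad_L2fun[OF assms]])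
  have "(\<lambda>x. grad \<Omega> v x $ i $ i) \<in> borel_measurable (lebesgue_on \<Omega>)" for i
    by (rule L2fun_measurable[OF L2fun_nth[OF L2fun_nth[OF H10_grad_L2fun[OF assms]]]])
  then have "(\<lambda>x. \<Sum>i\<in>UNIV. grad \<Omega> v x $ i $ i) \<in> borel_measurable (lebesgue_on \<Omega>)"
    by (rule borel_measurable_sum)
  then show "divg \<Omega> v \<in> borel_measurable (lebesgue_on \<Omega>)"
    by (simp add: divg_def[abs_def])
qed (use divg_abs_le in simp)

lemma divg_lincomb:
  assumes "u \<in> H10 \<Omega>" "v \<in> H10 \<Omega>"
  shows "AE x in lebesgue_on \<Omega>. divg \<Omega> (\<lambda>x. a *\<^sub>R u x + b *\<^sub>R v x) x = a * divg \<Omega> u x + b * divg \<Omega> v x"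
  using grad_lincomb[OF assms, of a b]
  by eventually_elim (simp add: divg_def sum.distrib sum_distrib_left)

text \<open>The pointwise identity is demanded only almost everywhere, since that is how
  \<open>grad\<close> and \<open>divg\<close> are linear.\<close>

lemma integral_lincomb_AE:
  fixes f g h :: "real^'d \<Rightarrow> real"
  assumes "integrable (lebesgue_on \<Omega>) f" "integrable (lebesgue_on \<Omega>) g" "integrable (lebesgue_on \<Omega>) h"
    "AE x in lebesgue_on \<Omega>. h x = a * f x + b * g x"
  shows "integral\<^sup>L (lebesgue_on \<Omega>) h = a * integral\<^sup>L (lebesgue_on \<Omega>) f + b * integral\<^sup>L (lebesgue_on \<Omega>) g"
proof -
  have "integral\<^sup>L (lebesgue_on \<Omega>) h = (\<integral>x. a * f x + b * g x \<partial>lebesgue_on \<Omega>)"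
    using assms by (intro integral_cong_AE) auto
  then show ?thesis using assms by simp
qed

text \<open>Mixing Picard updates must not leave the discrete space, as differences of iterates
  serve as test functions.\<close>

lemma Vh_lincomb:
  assumes Xh: "fin_subspace Xh" "Xh \<subseteq> H10 \<Omega>" and Qh: "Qh \<subseteq> Q0 \<Omega>"
    and u: "u \<in> Vh \<Omega> Xh Qh" and v: "v \<in> Vh \<Omega> Xh Qh"
  shows "(\<lambda>x. a *\<^sub>R u x + b *\<^sub>R v x) \<in> Vh \<Omega> Xh Qh"
proof -
  have X: "u \<in> Xh" "v \<in> Xh" "u \<in> H10 \<Omega>" "v \<in> H10 \<Omega>" using u v Xh by (auto simp: Vh_def)
  have "(\<integral>x. divg \<Omega> (\<lambda>x. a *\<^sub>R u x + b *\<^sub>R v x) x * q x \<partial>lebesgue_on \<Omega>) = 0" if q: "q \<in> Qh" for q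
  proof -
    have L: "L2fun \<Omega> q" using q Qh by (auto simp: Q0_def)
    have "(\<integral>x. divg \<Omega> (\<lambda>x. a *\<^sub>R u x + b *\<^sub>R v x) x * q x \<partial>lebesgue_on \<Omega>)
        = a * (\<integral>x. divg \<Omega> u x * q x \<partial>lebesgue_on \<Omega>) + b * (\<integral>x. divg \<Omega> v x * q x \<partial>lebesgue_on \<Omega>)"
    proof (rule integral_lincomb_AE)
      show "AE x in lebesgue_on \<Omega>. divg \<Omega> (\<lambda>x. a *\<^sub>R u x + b *\<^sub>R v x) x * q x
          = a * (divg \<Omega> u x * q x) + b * (divg \<Omega> v x * q x)"
        using divg_lincomb[OF X(3,4), of a b] by eventually_elim (simp add: algebra_simps)
    qed (intro L2fun_mult_integrable divg_L2fun L H10_lincomb X)+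
    then show ?thesis using u v q by (simp add: Vh_def set_integral_domain)
  qed
  moreover have "(\<lambda>x. a *\<^sub>R u x + b *\<^sub>R v x) \<in> Xh" using Xh(1) X unfolding fin_subspace_def by blast
  ultimately show ?thesis by (simp add: Vh_def set_integral_domain)
qed

end

text \<open>Membership in \<open>L\<^sup>6\<close> is not implied by the Sobolev inequality as stated, because the integral of
  a non-integrable function is 0; it is recovered from test functions by Fatou's lemma.\<close>

locale sobolev_domain = open_domain \<Omega> for \<Omega> :: "(real^'d::finite) set" +
  fixes CP C3 C6 :: real
  assumes poincare: "\<And>\<phi>. \<phi> \<in> H10 \<Omega> \<Longrightarrow> L2n \<Omega> \<phi> \<le> CP * h1n \<Omega> \<phi>"
    and sobolev6: "\<And>\<phi>. \<phi> \<in> H10 \<Omega> \<Longrightarrow> Lpn 6 \<Omega> \<phi> \<le> C6 * h1n \<Omega> \<phi>"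
    and sobolev3: "\<And>\<phi>. \<phi> \<in> H10 \<Omega> \<Longrightarrow> Lpn 3 \<Omega> \<phi> \<le> C3 * sqrt (L2n \<Omega> \<phi>) * sqrt (h1n \<Omega> \<phi>)"
begin

lemma H10_integrable_6:
  assumes u: "u \<in> H10 \<Omega>" shows "integrable (lebesgue_on \<Omega>) (\<lambda>x. norm (u x) ^ 6)"
proof -
  obtain \<phi> where \<phi>: "\<And>n i. test_fun \<Omega> (\<lambda>x. \<phi> n x $ i)" "\<And>n. \<phi> n \<in> H10 \<Omega>"
    "(\<lambda>n. L2n \<Omega> (\<lambda>x. \<phi> n x - u x)) \<longlonglongrightarrow> 0" "(\<lambda>n. h1n \<Omega> (\<lambda>x. \<phi> n x - u x)) \<longlonglongrightarrow> 0"
    using H10_approx[OF u] by blast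
  \<comment> \<open>Convergence in the gradient norm bounds it along the sequence, which gives
    Fatou's lemma a bound uniform in \<open>n\<close>.\<close>
  obtain B where B: "\<And>n. \<bar>h1n \<Omega> (\<lambda>x. \<phi> n x - u x)\<bar> \<le> B"
    using convergent_imp_Bseq[OF convergentI[OF \<phi>(4)]] by (auto simp: Bseq_def)
  have h: "h1n \<Omega> (\<phi> n) \<le> B + h1n \<Omega> u" for n
    using h1n_lincomb_le[OF H10_diff[OF \<phi>(2)[of n] u] u, of 1 1] B[of n] by simp
  have L2d: "L2fun \<Omega> (\<lambda>x. \<phi> n x - u x)" for n
    by (intro L2fun_diff H10_L2fun \<phi> u)
  have sq: "(\<integral>x. (norm (\<phi> n x - u x))\<^sup>2 \<partial>lebesgue_on \<Omega>) = (L2n \<Omega> (\<lambda>x. \<phi> n x - u x))\<^sup>2" for n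
    by (simp add: L2n_eq)
  show ?thesis
  proof (rule integrable_power_of_L2_limit)
    show "u \<in> borel_measurable (lebesgue_on \<Omega>)" "\<phi> n \<in> borel_measurable (lebesgue_on \<Omega>)" for n
      by (intro L2fun_measurable H10_L2fun \<phi> u)+
    show "integrable (lebesgue_on \<Omega>) (\<lambda>x. (norm (\<phi> n x - u x))\<^sup>2)" for n
      using L2d by (simp add: L2fun_iff)
    show "(\<lambda>n. \<integral>x. (norm (\<phi> n x - u x))\<^sup>2 \<partial>lebesgue_on \<Omega>) \<longlonglongrightarrow> 0"
      unfolding sq using \<phi>(3) by (auto intro!: tendsto_eq_intros)
    show "integrable (lebesgue_on \<Omega>) (\<lambda>x. norm (\<phi> n x) ^ 6)" for n
      by (rule test_field_integrable_power) (use \<phi> in auto)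
    fix n
    \<comment> \<open>The sign of \<open>C6\<close> is not known here, hence its absolute
      value.\<close>
    have "Lpn 6 \<Omega> (\<phi> n) \<le> \<bar>C6\<bar> * (B + h1n \<Omega> u)"
      using sobolev6[OF \<phi>(2)[of n]] mult_right_mono[OF abs_ge_self[of C6] h1n_nonneg[of "\<phi> n"]]
        mult_left_mono[OF h[of n] abs_ge_zero[of C6]] by linarith
    then have "Lpn 6 \<Omega> (\<phi> n) ^ 6 \<le> (\<bar>C6\<bar> * (B + h1n \<Omega> u)) ^ 6"
      by (intro power_mono) auto
    then show "(\<integral>x. norm (\<phi> n x) ^ 6 \<partial>lebesgue_on \<Omega>) \<le> (\<bar>C6\<bar> * (B + h1n \<Omega> u)) ^ 6"
      by (cases "(\<integral>x. norm (\<phi> n x) ^ 6 \<partial>lebesgue_on \<Omega>) = 0") (auto simp: Lpn_6_eq powr_power)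
  qed
qed

lemma H10_integrable_3:
  assumes u: "u \<in> H10 \<Omega>" shows "integrable (lebesgue_on \<Omega>) (\<lambda>x. norm (u x) ^ 3)"
proof -
  have "integrable (lebesgue_on \<Omega>) (\<lambda>x. (norm (u x))\<^sup>2 + norm (u x) ^ 6)"
    using H10_integrable_6[OF u] H10_L2fun[OF u] by (simp add: L2fun_iff)
  moreover have "(\<lambda>x. norm (u x) ^ 3) \<in> borel_measurable (lebesgue_on \<Omega>)"
    using L2fun_measurable[OF H10_L2fun[OF u]] by measurable
  \<comment> \<open>Up to 1 the square dominates the cube, beyond 1 the sixth power does.\<close>
  moreover have "t ^ 3 \<le> t\<^sup>2 + t ^ 6" if "t \<ge> 0" for t :: real
  proof (cases "t \<le> 1")
    case True
    then have "t ^ 3 \<le> t\<^sup>2" using that by (intro power_decreasing) auto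
    then show ?thesis using that by (simp add: add_increasing2)
  next
    case False
    then have "t ^ 3 \<le> t ^ 6" by (intro power_increasing) auto
    then show ?thesis by (simp add: add_increasing)
  qed
  then have "AE x in lebesgue_on \<Omega>. norm (norm (u x) ^ 3) \<le> norm ((norm (u x))\<^sup>2 + norm (u x) ^ 6)"
    by (intro AE_I2) (simp add: abs_of_nonneg)
  ultimately show ?thesis by (rule Bochner_Integration.integrable_bound)
qed

text \<open>The integrand stays abstract, with only its bound by a product of three norms, so that
  one estimate covers both integrals of \<open>bstar\<close>.\<close>

lemma trilinear_bound:
  fixes F :: "real^'d \<Rightarrow> 'b::euclidean_space"
  assumes F: "L2fun \<Omega> F" and b: "b \<in> H10 \<Omega>" and c: "c \<in> H10 \<Omega>"
    and T: "T \<in> borel_measurable (lebesgue_on \<Omega>)" "\<And>x. \<bar>T x\<bar> \<le> norm (F x) * norm (b x) * norm (c x)"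
  shows "integrable (lebesgue_on \<Omega>) T"
    and "\<bar>\<integral>x. T x \<partial>lebesgue_on \<Omega>\<bar> \<le> L2n \<Omega> F * Lpn 3 \<Omega> b * Lpn 6 \<Omega> c"
proof -
  have m: "(\<lambda>x. norm (F x)) \<in> borel_measurable (lebesgue_on \<Omega>)"
    "(\<lambda>x. norm (b x)) \<in> borel_measurable (lebesgue_on \<Omega>)"
    "(\<lambda>x. norm (c x)) \<in> borel_measurable (lebesgue_on \<Omega>)"
    using L2fun_measurable[OF F] L2fun_measurable[OF H10_L2fun[OF b]] L2fun_measurable[OF H10_L2fun[OF c]]
    by measurable
  have i: "integrable (lebesgue_on \<Omega>) (\<lambda>x. (norm (F x))\<^sup>2)"
    "integrable (lebesgue_on \<Omega>) (\<lambda>x. \<bar>norm (b x)\<bar> ^ 3)"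
    "integrable (lebesgue_on \<Omega>) (\<lambda>x. \<bar>norm (c x)\<bar> ^ 6)"
    using F H10_integrable_3[OF b] H10_integrable_6[OF c] by (simp_all add: L2fun_iff)
  note H = Holder_236[OF m i]
  show iT: "integrable (lebesgue_on \<Omega>) T"
    using H(1) T(1) by (rule Bochner_Integration.integrable_bound) (use T(2) in \<open>auto intro!: AE_I2\<close>)
  have "\<bar>\<integral>x. T x \<partial>lebesgue_on \<Omega>\<bar> \<le> (\<integral>x. \<bar>norm (F x) * norm (b x) * norm (c x)\<bar> \<partial>lebesgue_on \<Omega>)"
    using Bochner_Integration.integral_norm_bound_integral[OF iT H(1)] T(2) by (simp add: abs_mult)
  also have "\<dots> \<le> L2n \<Omega> F * Lpn 3 \<Omega> b * Lpn 6 \<Omega> c"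
    using H(2) by (simp add: L2n_eq Lpn_3_eq Lpn_6_eq)
  finally show "\<bar>\<integral>x. T x \<partial>lebesgue_on \<Omega>\<bar> \<le> L2n \<Omega> F * Lpn 3 \<Omega> b * Lpn 6 \<Omega> c" .
qed

text \<open>\<open>conv\<close> and \<open>dvg\<close> are the two integrals of
  \<open>bstar\<close>, the second without its factor 1/2, because these are the weights in the skew
  identity.\<close>

definition conv :: "(real^'d \<Rightarrow> real^'d) \<Rightarrow> (real^'d \<Rightarrow> real^'d) \<Rightarrow> (real^'d \<Rightarrow> real^'d) \<Rightarrow> real" where
  "conv v w z = (\<integral>x. (grad \<Omega> w x *v v x) \<bullet> z x \<partial>lebesgue_on \<Omega>)"

definition dvg :: "(real^'d \<Rightarrow> real^'d) \<Rightarrow> (real^'d \<Rightarrow> real^'d) \<Rightarrow> (real^'d \<Rightarrow> real^'d) \<Rightarrow> real" where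
  "dvg v w z = (\<integral>x. divg \<Omega> v x * (w x \<bullet> z x) \<partial>lebesgue_on \<Omega>)"

lemma bstar_eq: "bstar \<Omega> v w z = conv v w z + dvg v w z / 2"
  by (simp add: bstar_def conv_def dvg_def set_integral_domain)

text \<open>The L3 slot goes to the transporting field \<open>v\<close>: the L3 bound is the one
  that interpolates, and \<open>v\<close> is where the optimized residual will stand.\<close>

lemma
  assumes v: "v \<in> H10 \<Omega>" and w: "w \<in> H10 \<Omega>" and z: "z \<in> H10 \<Omega>"
  shows conv_integrable: "integrable (lebesgue_on \<Omega>) (\<lambda>x. (grad \<Omega> w x *v v x) \<bullet> z x)"
    and conv_bound: "\<bar>conv v w z\<bar> \<le> h1n \<Omega> w * Lpn 3 \<Omega> v * Lpn 6 \<Omega> z"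
proof -
  have [measurable]: "(\<lambda>x. grad \<Omega> w x $ i $ l) \<in> borel_measurable (lebesgue_on \<Omega>)"
    "(\<lambda>x. v x $ i) \<in> borel_measurable (lebesgue_on \<Omega>)" "(\<lambda>x. z x $ i) \<in> borel_measurable (lebesgue_on \<Omega>)" for i l
    using L2fun_measurable[OF L2fun_nth[OF L2fun_nth[OF H10_grad_L2fun[OF w]]]]
      L2fun_measurable[OF L2fun_nth[OF H10_L2fun[OF v]]] L2fun_measurable[OF L2fun_nth[OF H10_L2fun[OF z]]]
    by auto
  have "(\<lambda>x. \<Sum>i\<in>UNIV. (\<Sum>l\<in>UNIV. grad \<Omega> w x $ i $ l * v x $ l) * z x $ i) \<in> borel_measurable (lebesgue_on \<Omega>)"
    by measurable
  then have m: "(\<lambda>x. (grad \<Omega> w x *v v x) \<bullet> z x) \<in> borel_measurable (lebesgue_on \<Omega>)"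
    by (simp add: inner_vec_def matrix_vector_mult_def)
  have b: "\<bar>(grad \<Omega> w x *v v x) \<bullet> z x\<bar> \<le> norm (grad \<Omega> w x) * norm (v x) * norm (z x)" for x
    using order_trans[OF Cauchy_Schwarz_ineq2 mult_right_mono[OF norm_matrix_vector_mult_le norm_ge_zero]] .
  note * = trilinear_bound[OF H10_grad_L2fun[OF w] v z m b]
  show "integrable (lebesgue_on \<Omega>) (\<lambda>x. (grad \<Omega> w x *v v x) \<bullet> z x)"
    "\<bar>conv v w z\<bar> \<le> h1n \<Omega> w * Lpn 3 \<Omega> v * Lpn 6 \<Omega> z"
    using * by (simp_all add: conv_def h1n_def)
qed

lemma
  assumes v: "v \<in> H10 \<Omega>" and w: "w \<in> H10 \<Omega>" and z: "z \<in> H10 \<Omega>"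
  shows dvg_integrable: "integrable (lebesgue_on \<Omega>) (\<lambda>x. divg \<Omega> v x * (w x \<bullet> z x))"
    and dvg_bound: "\<bar>dvg v w z\<bar> \<le> real CARD('d) * h1n \<Omega> v * Lpn 3 \<Omega> w * Lpn 6 \<Omega> z"
proof -
  have [measurable]: "divg \<Omega> v \<in> borel_measurable (lebesgue_on \<Omega>)"
    "w \<in> borel_measurable (lebesgue_on \<Omega>)" "z \<in> borel_measurable (lebesgue_on \<Omega>)"
    by (intro L2fun_measurable divg_L2fun H10_L2fun v w z)+
  have m: "(\<lambda>x. divg \<Omega> v x * (w x \<bullet> z x)) \<in> borel_measurable (lebesgue_on \<Omega>)"
    by measurable
  note d = divg_abs_le[of v]
  have b: "\<bar>divg \<Omega> v x * (w x \<bullet> z x)\<bar> \<le> norm (real CARD('d) *\<^sub>R grad \<Omega> v x) * norm (w x) * norm (z x)" for x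
    using mult_mono[OF d[of x] Cauchy_Schwarz_ineq2[of "w x" "z x"]] by (simp add: abs_mult mult.assoc)
  note * = trilinear_bound[OF L2fun_scaleR[OF H10_grad_L2fun[OF v]] w z m b]
  show "integrable (lebesgue_on \<Omega>) (\<lambda>x. divg \<Omega> v x * (w x \<bullet> z x))"
    "\<bar>dvg v w z\<bar> \<le> real CARD('d) * h1n \<Omega> v * Lpn 3 \<Omega> w * Lpn 6 \<Omega> z"
    using * by (simp_all add: dvg_def h1n_def L2n_scaleR)
qed

section \<open>Linearity and symmetry of the two integrals\<close>

lemma conv_lincomb1:
  assumes "u \<in> H10 \<Omega>" "v \<in> H10 \<Omega>" "w \<in> H10 \<Omega>" "z \<in> H10 \<Omega>"
  shows "conv (\<lambda>x. a *\<^sub>R u x + b *\<^sub>R v x) w z = a * conv u w z + b * conv v w z"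
  unfolding conv_def
  by (rule integral_lincomb_AE)
    (use assms in \<open>auto intro!: conv_integrable H10_lincomb AE_I2
      simp: matrix_vector_right_distrib matrix_vector_mult_scaleR inner_add_left\<close>)

lemma conv_lincomb2:
  assumes "u \<in> H10 \<Omega>" "v \<in> H10 \<Omega>" "w \<in> H10 \<Omega>" "z \<in> H10 \<Omega>"
  shows "conv w (\<lambda>x. a *\<^sub>R u x + b *\<^sub>R v x) z = a * conv w u z + b * conv w v z"
  unfolding conv_def
proof (rule integral_lincomb_AE)
  show "AE x in lebesgue_on \<Omega>. (grad \<Omega> (\<lambda>x. a *\<^sub>R u x + b *\<^sub>R v x) x *v w x) \<bullet> z x =
      a * ((grad \<Omega> u x *v w x) \<bullet> z x) + b * ((grad \<Omega> v x *v w x) \<bullet> z x)"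
    using grad_lincomb[OF assms(1,2), of a b]
    by eventually_elim (simp add: matrix_vector_mult_add_rdistrib scaleR_matrix_vector_assoc[symmetric] inner_add_left)
qed (intro conv_integrable H10_lincomb assms)+

lemma conv_lincomb3:
  assumes "u \<in> H10 \<Omega>" "v \<in> H10 \<Omega>" "w \<in> H10 \<Omega>" "z \<in> H10 \<Omega>"
  shows "conv w z (\<lambda>x. a *\<^sub>R u x + b *\<^sub>R v x) = a * conv w z u + b * conv w z v"
  unfolding conv_def
  by (rule integral_lincomb_AE)
    (use assms in \<open>auto intro!: conv_integrable H10_lincomb AE_I2 simp: inner_add_right\<close>)

lemma dvg_lincomb1:
  assumes "u \<in> H10 \<Omega>" "v \<in> H10 \<Omega>" "w \<in> H10 \<Omega>" "z \<in> H10 \<Omega>"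
  shows "dvg (\<lambda>x. a *\<^sub>R u x + b *\<^sub>R v x) w z = a * dvg u w z + b * dvg v w z"
  unfolding dvg_def
proof (rule integral_lincomb_AE)
  show "AE x in lebesgue_on \<Omega>. divg \<Omega> (\<lambda>x. a *\<^sub>R u x + b *\<^sub>R v x) x * (w x \<bullet> z x) =
      a * (divg \<Omega> u x * (w x \<bullet> z x)) + b * (divg \<Omega> v x * (w x \<bullet> z x))"
    using divg_lincomb[OF assms(1,2), of a b] by eventually_elim (simp add: algebra_simps)
qed (intro dvg_integrable H10_lincomb assms)+

lemma dvg_lincomb2:
  assumes "u \<in> H10 \<Omega>" "v \<in> H10 \<Omega>" "w \<in> H10 \<Omega>" "z \<in> H10 \<Omega>"
  shows "dvg w (\<lambda>x. a *\<^sub>R u x + b *\<^sub>R v x) z = a * dvg w u z + b * dvg w v z"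
  unfolding dvg_def
  by (rule integral_lincomb_AE)
    (use assms in \<open>auto intro!: dvg_integrable H10_lincomb AE_I2 simp: inner_add_left algebra_simps\<close>)

lemma dvg_sym: "dvg v w z = dvg v z w"
  by (simp add: dvg_def inner_commute)

lemma skew_test_fields:
  assumes v: "v \<in> H10 \<Omega>"
    and \<phi>: "\<And>i. test_fun \<Omega> (\<lambda>x. \<phi> x $ i)" and \<psi>: "\<And>i. test_fun \<Omega> (\<lambda>x. \<psi> x $ i)"
  shows "conv v \<phi> \<psi> + conv v \<psi> \<phi> + dvg v \<phi> \<psi> = 0"
proof -
  note H = test_field_H10[of \<phi>, OF \<phi>] test_field_H10[of \<psi>, OF \<psi>]
  define q where "q x = (\<Sum>i\<in>UNIV. \<phi> x $ i * \<psi> x $ i)" for x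
  have q: "test_fun \<Omega> q"
    unfolding q_def by (intro test_fun_sum test_fun_mult \<phi> test_fun_smooth[OF \<psi>])
  have d: "(\<lambda>x. \<phi> x $ i) differentiable (at x)" "(\<lambda>x. \<psi> x $ i) differentiable (at x)" for i x
    by (intro smooth_fun_differentiable_at test_fun_smooth[OF \<phi>] test_fun_smooth[OF \<psi>])+
  have dm: "(\<lambda>x. \<phi> x $ i * \<psi> x $ i) differentiable (at x)" for i x
    by (intro smooth_fun_differentiable_at test_fun_smooth[OF test_fun_mult[OF \<phi> test_fun_smooth[OF \<psi>]]])
  have dq: "partial_at l q x = (\<Sum>i\<in>UNIV. cgrad \<phi> x $ i $ l * \<psi> x $ i + \<phi> x $ i * cgrad \<psi> x $ i $ l)" for l x
    unfolding q_def using d dm by (simp add: partial_at_sum partial_at_mult cgrad_def)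
  let ?J = "\<lambda>x. (grad \<Omega> \<phi> x *v v x) \<bullet> \<psi> x + (grad \<Omega> \<psi> x *v v x) \<bullet> \<phi> x + divg \<Omega> v x * (\<phi> x \<bullet> \<psi> x)"
  \<comment> \<open>Each summand is the weak derivative identity for component \<open>l\<close> of
    \<open>v\<close> in direction \<open>l\<close>, tested with \<open>q\<close>, so it integrates
    to zero; the diagonal entries add up to the divergence.\<close>
  let ?S = "\<lambda>x. \<Sum>l\<in>UNIV. v x $ l * partial_at l q x + grad \<Omega> v x $ l $ l * q x"
  have w: "integrable (lebesgue_on \<Omega>) (\<lambda>x. v x $ l * partial_at l q x)"
    "integrable (lebesgue_on \<Omega>) (\<lambda>x. grad \<Omega> v x $ l $ l * q x)"
    "(\<integral>x. v x $ l * partial_at l q x \<partial>lebesgue_on \<Omega>) = - (\<integral>x. grad \<Omega> v x $ l $ l * q x \<partial>lebesgue_on \<Omega>)" for l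
    using H10_weak_grad[OF v] q by (auto simp: weak_grad_iff)
  have ae: "AE x in lebesgue_on \<Omega>. ?J x = ?S x"
    using grad_AE_eq[OF test_field_weak_grad[of \<phi>, OF \<phi>]] grad_AE_eq[OF test_field_weak_grad[of \<psi>, OF \<psi>]]
  proof eventually_elim
    case (elim x)
    \<comment> \<open>The direction index \<open>l\<close> becomes the outer one, to match
      \<open>?S\<close>.\<close>
    have 1: "(A *v y) \<bullet> z = (\<Sum>l\<in>UNIV. \<Sum>i\<in>UNIV. y $ l * (A $ i $ l * z $ i))" for A :: "real^'d^'d" and y z
      unfolding inner_vec_def matrix_vector_mult_def
      by (subst sum.swap) (simp add: sum_distrib_right sum_distrib_left mult_ac)
    have "?S x = (\<Sum>l\<in>UNIV. \<Sum>i\<in>UNIV. v x $ l * (cgrad \<phi> x $ i $ l * \<psi> x $ i))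
        + (\<Sum>l\<in>UNIV. \<Sum>i\<in>UNIV. v x $ l * (cgrad \<psi> x $ i $ l * \<phi> x $ i))
        + (\<Sum>l\<in>UNIV. grad \<Omega> v x $ l $ l * q x)"
      by (simp add: dq sum.distrib sum_distrib_left distrib_left mult_ac)
    also have qx: "q x = \<phi> x \<bullet> \<psi> x" by (simp add: q_def inner_vec_def)
    also have "(\<Sum>l\<in>UNIV. \<Sum>i\<in>UNIV. v x $ l * (cgrad \<phi> x $ i $ l * \<psi> x $ i))
        + (\<Sum>l\<in>UNIV. \<Sum>i\<in>UNIV. v x $ l * (cgrad \<psi> x $ i $ l * \<phi> x $ i))
        + (\<Sum>l\<in>UNIV. grad \<Omega> v x $ l $ l * (\<phi> x \<bullet> \<psi> x)) = ?J x"
      by (simp add: elim 1 divg_def sum_distrib_right)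
    finally show ?case by (simp add: qx)
  qed
  have i: "integrable (lebesgue_on \<Omega>) ?J"
    by (intro Bochner_Integration.integrable_add conv_integrable dvg_integrable H v)
  have "conv v \<phi> \<psi> + conv v \<psi> \<phi> + dvg v \<phi> \<psi> = integral\<^sup>L (lebesgue_on \<Omega>) ?J"
    unfolding conv_def dvg_def using conv_integrable dvg_integrable H v by simp
  also have "\<dots> = integral\<^sup>L (lebesgue_on \<Omega>) ?S"
  proof (rule integral_cong_AE[OF _ _ ae])
    show "?J \<in> borel_measurable (lebesgue_on \<Omega>)" using i by simp
    show "?S \<in> borel_measurable (lebesgue_on \<Omega>)"
      by (intro borel_measurable_sum borel_measurable_add borel_measurable_integrable w)
  qed
  also have "\<dots> = 0" using w by simp
  finally show ?thesis .
qed

text \<open>Approximation is available in the gradient norm, so \<open>w\<close> must sit in the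
  gradient slot or in the L6 slot of every term; symmetry of \<open>dvg\<close> in its last two
  arguments arranges this.\<close>

lemma skew_bound:
  assumes v: "v \<in> H10 \<Omega>" and w: "w \<in> H10 \<Omega>" and z: "z \<in> H10 \<Omega>"
  shows "\<bar>conv v w z + conv v z w + dvg v w z\<bar> \<le>
    (Lpn 3 \<Omega> v * Lpn 6 \<Omega> z + h1n \<Omega> z * Lpn 3 \<Omega> v * C6 + real CARD('d) * h1n \<Omega> v * Lpn 3 \<Omega> z * C6) * h1n \<Omega> w"
proof -
  note 1 = conv_bound[OF v w z]
  note 2 = order_trans[OF conv_bound[OF v z w] mult_left_mono[OF sobolev6[OF w]]]
  note 3 = order_trans[OF dvg_bound[OF v z w] mult_left_mono[OF sobolev6[OF w]]]
  show ?thesis using 1 2 3 by (simp add: dvg_sym[of v w z] algebra_simps)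
qed

lemma skew_diff:
  assumes "v \<in> H10 \<Omega>" "w \<in> H10 \<Omega>" "w' \<in> H10 \<Omega>" "z \<in> H10 \<Omega>"
  shows "conv v (\<lambda>x. w x - w' x) z + conv v z (\<lambda>x. w x - w' x) + dvg v (\<lambda>x. w x - w' x) z
    = (conv v w z + conv v z w + dvg v w z) - (conv v w' z + conv v z w' + dvg v w' z)"
  using conv_lincomb2[of w w' v z 1 "-1"] conv_lincomb3[of w w' v z 1 "-1"]
    dvg_lincomb2[of w w' v z 1 "-1"] assms by simp

text \<open>Density in one argument with the other fixed. As the identity is symmetric in
  \<open>w\<close> and \<open>z\<close>, the same passage to the limit serves both arguments in
  turn.\<close>

lemma skew_limit:
  assumes v: "v \<in> H10 \<Omega>" and w: "w \<in> H10 \<Omega>" and z: "z \<in> H10 \<Omega>"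
    and tests: "\<And>\<phi> :: real^'d \<Rightarrow> real^'d. (\<And>i. test_fun \<Omega> (\<lambda>x. \<phi> x $ i)) \<Longrightarrow> conv v \<phi> z + conv v z \<phi> + dvg v \<phi> z = 0"
  shows "conv v w z + conv v z w + dvg v w z = 0"
proof -
  obtain \<phi> where \<phi>: "\<And>n i. test_fun \<Omega> (\<lambda>x. \<phi> n x $ i)" "\<And>n. \<phi> n \<in> H10 \<Omega>"
    "(\<lambda>n. L2n \<Omega> (\<lambda>x. \<phi> n x - w x)) \<longlonglongrightarrow> 0" "(\<lambda>n. h1n \<Omega> (\<lambda>x. \<phi> n x - w x)) \<longlonglongrightarrow> 0"
    using H10_approx[OF w] by blast
  define K where "K = Lpn 3 \<Omega> v * Lpn 6 \<Omega> z + h1n \<Omega> z * Lpn 3 \<Omega> v * C6 + real CARD('d) * h1n \<Omega> v * Lpn 3 \<Omega> z * C6"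
  have le: "\<bar>conv v w z + conv v z w + dvg v w z\<bar> \<le> K * h1n \<Omega> (\<lambda>x. \<phi> n x - w x)" for n
    using skew_bound[OF v H10_diff[OF \<phi>(2) w] z, of n] skew_diff[OF v \<phi>(2) w z, of n] tests[of "\<phi> n", OF \<phi>(1)]
    unfolding K_def by linarith
  have "(\<lambda>n. K * h1n \<Omega> (\<lambda>x. \<phi> n x - w x)) \<longlonglongrightarrow> K * 0"
    by (intro tendsto_intros \<phi>)
  then have "\<bar>conv v w z + conv v z w + dvg v w z\<bar> \<le> K * 0"
    by (rule LIMSEQ_le_const) (use le in auto)
  then show ?thesis by simp
qed

lemma skew_symmetry:
  assumes v: "v \<in> H10 \<Omega>" and w: "w \<in> H10 \<Omega>" and z: "z \<in> H10 \<Omega>"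
  shows "conv v w z + conv v z w + dvg v w z = 0"
proof (rule skew_limit[OF v w z])
  fix \<phi> :: "real^'d \<Rightarrow> real^'d" assume \<phi>: "\<And>i. test_fun \<Omega> (\<lambda>x. \<phi> x $ i)"
  have "conv v z \<phi> + conv v \<phi> z + dvg v z \<phi> = 0"
    by (rule skew_limit[OF v z test_field_H10[of \<phi>, OF \<phi>]]) (rule skew_test_fields[OF v _ \<phi>])
  then show "conv v \<phi> z + conv v z \<phi> + dvg v \<phi> z = 0" by (simp add: dvg_sym[of v z])
qed

text \<open>Skew-symmetry trades the divergence for a second convection integral, so the bounds
  below carry \<open>C3 * C6\<close> and no dimensional factor.\<close>

lemma bstar_skew:
  assumes "v \<in> H10 \<Omega>" "w \<in> H10 \<Omega>" "z \<in> H10 \<Omega>"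
  shows "bstar \<Omega> v w z = (conv v w z - conv v z w) / 2"
  using skew_symmetry[OF assms] by (simp add: bstar_eq)

lemma bstar_self: "v \<in> H10 \<Omega> \<Longrightarrow> w \<in> H10 \<Omega> \<Longrightarrow> bstar \<Omega> v w w = 0"
  by (simp add: bstar_skew)

lemma bstar_lincomb1:
  assumes "u \<in> H10 \<Omega>" "v \<in> H10 \<Omega>" "w \<in> H10 \<Omega>" "z \<in> H10 \<Omega>"
  shows "bstar \<Omega> (\<lambda>x. a *\<^sub>R u x + b *\<^sub>R v x) w z = a * bstar \<Omega> u w z + b * bstar \<Omega> v w z"
  using conv_lincomb1[OF assms] dvg_lincomb1[OF assms] by (simp add: bstar_eq algebra_simps add_divide_distrib)

lemma bstar_lincomb2:
  assumes "u \<in> H10 \<Omega>" "v \<in> H10 \<Omega>" "w \<in> H10 \<Omega>" "z \<in> H10 \<Omega>"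
  shows "bstar \<Omega> w (\<lambda>x. a *\<^sub>R u x + b *\<^sub>R v x) z = a * bstar \<Omega> w u z + b * bstar \<Omega> w v z"
  using conv_lincomb2[OF assms] dvg_lincomb2[OF assms] by (simp add: bstar_eq algebra_simps add_divide_distrib)

text \<open>Both convection integrals keep \<open>v\<close> in the L3 slot, so their bounds coincide
  and averaging does not change the constant.\<close>

lemma bstar_bound_interpolated:
  assumes v: "v \<in> H10 \<Omega>" and w: "w \<in> H10 \<Omega>" and z: "z \<in> H10 \<Omega>"
  shows "\<bar>bstar \<Omega> v w z\<bar> \<le> C3 * C6 * sqrt (L2n \<Omega> v) * sqrt (h1n \<Omega> v) * h1n \<Omega> w * h1n \<Omega> z"
proof -
  have 1: "\<bar>conv v a b\<bar> \<le> C3 * C6 * sqrt (L2n \<Omega> v) * sqrt (h1n \<Omega> v) * h1n \<Omega> a * h1n \<Omega> b"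
    if a: "a \<in> H10 \<Omega>" and b: "b \<in> H10 \<Omega>" for a b
  proof -
    have "\<bar>conv v a b\<bar> \<le> h1n \<Omega> a * Lpn 3 \<Omega> v * Lpn 6 \<Omega> b" by (rule conv_bound[OF v a b])
    also have "\<dots> \<le> h1n \<Omega> a * (C3 * sqrt (L2n \<Omega> v) * sqrt (h1n \<Omega> v)) * (C6 * h1n \<Omega> b)"
      \<comment> \<open>No sign of \<open>C3\<close> is available; its factor is nonnegative because
        it dominates an L3 norm.\<close>
      by (intro mult_mono mult_left_mono sobolev3[OF v] sobolev6[OF b] mult_nonneg_nonneg
          order_trans[OF Lpn_nonneg sobolev3[OF v]]) auto
    finally show ?thesis by (simp add: mult_ac)
  qed
  show ?thesis using 1[OF w z] 1[OF z w] by (simp add: bstar_skew[OF v w z] mult_ac)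
qed

text \<open>One field with nonzero gradient norm forces the signs, since each constant times
  positive norms dominates a norm; \<open>CP\<close> is strictly positive because the L2 norm of the
  field is.\<close>

lemma constants_nonneg:
  assumes v: "v \<in> H10 \<Omega>" and "h1n \<Omega> v \<noteq> 0"
  shows "CP > 0" "C3 \<ge> 0" "C6 \<ge> 0"
proof -
  have h: "h1n \<Omega> v > 0" using assms(2) h1n_nonneg[of v] by linarith
  have l: "L2n \<Omega> v > 0" using h1n_eq_0_of_L2n_eq_0[OF v] assms(2) by (auto simp: order_less_le)
  show "CP > 0" using less_le_trans[OF l poincare[OF v]] h by (simp add: zero_less_mult_iff)
  show "C6 \<ge> 0" using order_trans[OF Lpn_nonneg sobolev6[OF v]] h by (simp add: zero_le_mult_iff)
  show "C3 \<ge> 0" using order_trans[OF Lpn_nonneg sobolev3[OF v]] h l by (simp add: zero_le_mult_iff)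
qed

lemma bstar_bound:
  assumes v: "v \<in> H10 \<Omega>" and w: "w \<in> H10 \<Omega>" and z: "z \<in> H10 \<Omega>"
  shows "\<bar>bstar \<Omega> v w z\<bar> \<le> sqrt CP * C3 * C6 * h1n \<Omega> v * h1n \<Omega> w * h1n \<Omega> z"
proof (cases "h1n \<Omega> v = 0")
  \<comment> \<open>The signs of the constants are unknown here, but both right-hand sides are
    zero.\<close>
  case True
  then show ?thesis using bstar_bound_interpolated[OF v w z] by simp
next
  case False
  note c = constants_nonneg[OF v False]
  have "\<bar>bstar \<Omega> v w z\<bar> \<le> C3 * C6 * sqrt (L2n \<Omega> v) * sqrt (h1n \<Omega> v) * h1n \<Omega> w * h1n \<Omega> z"
    by (rule bstar_bound_interpolated[OF v w z])
  also have "\<dots> \<le> C3 * C6 * sqrt (CP * h1n \<Omega> v) * sqrt (h1n \<Omega> v) * h1n \<Omega> w * h1n \<Omega> z"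
    using c poincare[OF v] by (intro mult_right_mono mult_left_mono) auto
  also have "\<dots> = sqrt CP * C3 * C6 * h1n \<Omega> v * h1n \<Omega> w * h1n \<Omega> z"
    by (simp add: real_sqrt_mult mult_ac)
  finally show ?thesis .
qed

section \<open>The gradient inner product and the dual norm\<close>

lemma h1ip_self: "h1ip \<Omega> u u = (h1n \<Omega> u)\<^sup>2"
  by (simp add: h1ip_def h1n_def L2n_eq set_integral_domain power2_norm_eq_inner)

lemma h1ip_lincomb:
  assumes "u \<in> H10 \<Omega>" "v \<in> H10 \<Omega>" "z \<in> H10 \<Omega>"
  shows "h1ip \<Omega> (\<lambda>x. a *\<^sub>R u x + b *\<^sub>R v x) z = a * h1ip \<Omega> u z + b * h1ip \<Omega> v z"
  unfolding h1ip_def set_integral_domain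
proof (rule integral_lincomb_AE)
  show "AE x in lebesgue_on \<Omega>. grad \<Omega> (\<lambda>x. a *\<^sub>R u x + b *\<^sub>R v x) x \<bullet> grad \<Omega> z x
      = a * (grad \<Omega> u x \<bullet> grad \<Omega> z x) + b * (grad \<Omega> v x \<bullet> grad \<Omega> z x)"
    using grad_lincomb[OF assms(1,2), of a b] by eventually_elim (simp add: inner_add_left)
qed (intro L2fun_inner_integrable H10_grad_L2fun H10_lincomb assms)+

text \<open>The supremum ranges over fields with nonzero gradient norm and is finite by the
  continuity bound \<open>C\<close>; the other fields are covered by \<open>C\<close>
  directly.\<close>

lemma hm1n_bound:
  assumes f: "in_Hm1 \<Omega> f" and \<phi>: "\<phi> \<in> H10 \<Omega>"
  shows "\<bar>f \<phi>\<bar> \<le> hm1n \<Omega> f * h1n \<Omega> \<phi>"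
proof -
  obtain C where C: "\<And>\<phi>. \<phi> \<in> H10 \<Omega> \<Longrightarrow> \<bar>f \<phi>\<bar> \<le> C * h1n \<Omega> \<phi>"
    using f unfolding in_Hm1_def by blast
  show ?thesis
  proof (cases "h1n \<Omega> \<phi> = 0")
    case True
    then show ?thesis using C[OF \<phi>] by simp
  next
    case False
    have "\<bar>f \<phi>\<bar> / h1n \<Omega> \<phi> \<le> hm1n \<Omega> f"
      unfolding hm1n_def
    proof (rule cSup_upper)
      show "bdd_above {\<bar>f \<phi>\<bar> / h1n \<Omega> \<phi> |\<phi>. \<phi> \<in> H10 \<Omega> \<and> h1n \<Omega> \<phi> \<noteq> 0}"
        using C by (auto intro!: bdd_aboveI[of _ C] simp: divide_le_eq order_less_le)
    qed (use \<phi> False in auto)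
    then show ?thesis using False h1n_nonneg[of \<phi>] by (simp add: divide_le_eq order_less_le)
  qed
qed

end

section \<open>Anderson acceleration of the Picard iteration\<close>

text \<open>One factor \<open>h\<close> cancels; at \<open>h = 0\<close> the sign of
  \<open>c\<close> takes over.\<close>

lemma absorb_quadratic:
  fixes h :: real
  assumes "\<nu> > 0" "\<nu> * h\<^sup>2 \<le> c * h" "h \<ge> 0" "c \<ge> 0"
  shows "\<nu> * h \<le> c"
proof (cases "h = 0")
  case False
  then show ?thesis using assms mult_le_cancel_right[of "\<nu> * h" h c]
    by (simp add: power2_eq_square mult.assoc)
qed (use assms in simp)

context sobolev_domain
begin

text \<open>Testing the Picard equation with its own solution removes the convection term by
  skew-symmetry.\<close>

lemma picard_stability:
  assumes \<nu>: "\<nu> > 0" and f: "in_Hm1 \<Omega> f" "hm1n \<Omega> f \<ge> 0"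
    and u: "u \<in> H10 \<Omega>" and g: "g \<in> H10 \<Omega>"
    and eq: "\<nu> * h1ip \<Omega> g g + bstar \<Omega> u g g = f g"
  shows "h1n \<Omega> g \<le> hm1n \<Omega> f / \<nu>"
proof -
  have "\<nu> * (h1n \<Omega> g)\<^sup>2 \<le> hm1n \<Omega> f * h1n \<Omega> g"
    using eq hm1n_bound[OF f(1) g] by (simp add: bstar_self[OF u g] h1ip_self)
  then have "\<nu> * h1n \<Omega> g \<le> hm1n \<Omega> f" by (rule absorb_quadratic[OF \<nu>]) (use f in auto)
  then show ?thesis using \<nu> by (simp add: field_simps)
qed

text \<open>In the difference of the equations, tested with \<open>g\<^sub>1 - g\<^sub>2\<close>,
  skew-symmetry removes the transport of that difference by \<open>u\<^sub>1\<close>. What is left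
  transports \<open>g\<^sub>2\<close> by \<open>u\<^sub>1 - u\<^sub>2\<close>. One factor
  \<open>\<nu>\<close> comes from absorption, the other from stability of
  \<open>g\<^sub>2\<close>.\<close>

lemma picard_lipschitz:
  assumes \<nu>: "\<nu> > 0" and f: "in_Hm1 \<Omega> f" "hm1n \<Omega> f \<ge> 0" and M: "sqrt CP * C3 * C6 \<ge> 0"
    and u: "u\<^sub>1 \<in> H10 \<Omega>" "u\<^sub>2 \<in> H10 \<Omega>" and g: "g\<^sub>1 \<in> H10 \<Omega>" "g\<^sub>2 \<in> H10 \<Omega>"
    and V: "g\<^sub>2 \<in> V" "(\<lambda>x. g\<^sub>1 x - g\<^sub>2 x) \<in> V"
    and eq1: "\<And>v. v \<in> V \<Longrightarrow> \<nu> * h1ip \<Omega> g\<^sub>1 v + bstar \<Omega> u\<^sub>1 g\<^sub>1 v = f v"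
    and eq2: "\<And>v. v \<in> V \<Longrightarrow> \<nu> * h1ip \<Omega> g\<^sub>2 v + bstar \<Omega> u\<^sub>2 g\<^sub>2 v = f v"
  shows "\<nu>\<^sup>2 * h1n \<Omega> (\<lambda>x. g\<^sub>1 x - g\<^sub>2 x)
    \<le> sqrt CP * C3 * C6 * hm1n \<Omega> f * h1n \<Omega> (\<lambda>x. u\<^sub>1 x - u\<^sub>2 x)"
proof -
  let ?M = "sqrt CP * C3 * C6"
  let ?d = "\<lambda>x. g\<^sub>1 x - g\<^sub>2 x" and ?e = "\<lambda>x. u\<^sub>1 x - u\<^sub>2 x"
  have d: "?d \<in> H10 \<Omega>" and e: "?e \<in> H10 \<Omega>" by (intro H10_diff u g)+
  have "h1ip \<Omega> ?d ?d = h1ip \<Omega> g\<^sub>1 ?d - h1ip \<Omega> g\<^sub>2 ?d"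
    using h1ip_lincomb[OF g d, of 1 "-1"] by simp
  moreover have "bstar \<Omega> u\<^sub>1 g\<^sub>1 ?d = bstar \<Omega> u\<^sub>1 g\<^sub>2 ?d"
    using bstar_lincomb2[OF g u(1) d, of 1 "-1"] bstar_self[OF u(1) d] by simp
  moreover have "bstar \<Omega> ?e g\<^sub>2 ?d = bstar \<Omega> u\<^sub>1 g\<^sub>2 ?d - bstar \<Omega> u\<^sub>2 g\<^sub>2 ?d"
    using bstar_lincomb1[OF u g(2) d, of 1 "-1"] by simp
  moreover note eq1[OF V(2)] eq2[OF V(2)]
  ultimately have "\<nu> * h1ip \<Omega> ?d ?d = - bstar \<Omega> ?e g\<^sub>2 ?d" by algebra
  then have "\<nu> * (h1n \<Omega> ?d)\<^sup>2 = - bstar \<Omega> ?e g\<^sub>2 ?d" by (simp add: h1ip_self)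
  then have "\<nu> * (h1n \<Omega> ?d)\<^sup>2 \<le> (?M * h1n \<Omega> ?e * h1n \<Omega> g\<^sub>2) * h1n \<Omega> ?d"
    using bstar_bound[OF e g(2) d] by linarith
  then have "\<nu> * h1n \<Omega> ?d \<le> ?M * h1n \<Omega> ?e * h1n \<Omega> g\<^sub>2"
    by (rule absorb_quadratic[OF \<nu>]) (use M in auto)
  also have "\<dots> \<le> ?M * h1n \<Omega> ?e * (hm1n \<Omega> f / \<nu>)"
    using M picard_stability[OF \<nu> f u(2) g(2) eq2[OF V(1)]] by (intro mult_left_mono) auto
  finally show ?thesis using \<nu> by (simp add: field_simps power2_eq_square)
qed

text \<open>Testing with the new residual \<open>G - U\<close> annihilates \<open>bstar U (G - U)\<close>; what remains is linear in the
  optimized residual, plus a term that is quadratic in the increments.\<close>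

lemma anderson_residual_bound:
  fixes a\<^sub>0 a\<^sub>1 :: real and U r :: "real^'d \<Rightarrow> real^'d"
  assumes \<nu>: "\<nu> > 0" and f: "in_Hm1 \<Omega> f" "hm1n \<Omega> f \<ge> 0" and M: "C3 \<ge> 0" "C6 \<ge> 0" "sqrt CP \<ge> 0"
    and u: "u\<^sub>0 \<in> H10 \<Omega>" "u\<^sub>1 \<in> H10 \<Omega>" and g: "g\<^sub>0 \<in> H10 \<Omega>" "g\<^sub>1 \<in> H10 \<Omega>" "G \<in> H10 \<Omega>"
    and a: "a\<^sub>0 + a\<^sub>1 = 1"
  defines "U \<equiv> \<lambda>x. a\<^sub>0 *\<^sub>R g\<^sub>0 x + a\<^sub>1 *\<^sub>R g\<^sub>1 x"
    and "r \<equiv> \<lambda>x. a\<^sub>0 *\<^sub>R (g\<^sub>0 x - u\<^sub>0 x) + a\<^sub>1 *\<^sub>R (g\<^sub>1 x - u\<^sub>1 x)"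
  assumes V: "g\<^sub>0 \<in> V" "(\<lambda>x. G x - U x) \<in> V"
    and eq0: "\<And>v. v \<in> V \<Longrightarrow> \<nu> * h1ip \<Omega> g\<^sub>0 v + bstar \<Omega> u\<^sub>0 g\<^sub>0 v = f v"
    and eq1: "\<And>v. v \<in> V \<Longrightarrow> \<nu> * h1ip \<Omega> g\<^sub>1 v + bstar \<Omega> u\<^sub>1 g\<^sub>1 v = f v"
    and eqG: "\<And>v. v \<in> V \<Longrightarrow> \<nu> * h1ip \<Omega> G v + bstar \<Omega> U G v = f v"
  shows "\<nu> * h1n \<Omega> (\<lambda>x. G x - U x) \<le> C3 * C6 * sqrt (L2n \<Omega> r) * sqrt (h1n \<Omega> r) * (hm1n \<Omega> f / \<nu>)
    + \<bar>a\<^sub>1\<bar> * (sqrt CP * C3 * C6 * h1n \<Omega> (\<lambda>x. U x - u\<^sub>1 x) * h1n \<Omega> (\<lambda>x. g\<^sub>1 x - g\<^sub>0 x))"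
proof -
  let ?W = "\<lambda>x. G x - U x" and ?e = "\<lambda>x. U x - u\<^sub>1 x" and ?d = "\<lambda>x. g\<^sub>1 x - g\<^sub>0 x"
  let ?B = "\<lambda>p q. bstar \<Omega> p q ?W"
  have U: "U \<in> H10 \<Omega>" unfolding U_def by (intro H10_lincomb g)
  have W: "?W \<in> H10 \<Omega>" and e: "?e \<in> H10 \<Omega>" and d: "?d \<in> H10 \<Omega>" by (intro H10_diff U u g)+
  have r: "r \<in> H10 \<Omega>" unfolding r_def by (intro H10_lincomb H10_diff u g)
  \<comment> \<open>The same weights act on updates and old iterates, so \<open>r\<close> is
    \<open>U\<close> minus the mixed old iterate \<open>s\<close>.\<close>
  define s where "s = (\<lambda>x. a\<^sub>0 *\<^sub>R u\<^sub>0 x + a\<^sub>1 *\<^sub>R u\<^sub>1 x)"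
  have s: "s \<in> H10 \<Omega>" unfolding s_def by (intro H10_lincomb u)
  have r_eq: "r = (\<lambda>x. 1 *\<^sub>R U x + (-1) *\<^sub>R s x)"
    by (simp add: r_def U_def s_def algebra_simps)
  have "?B U G = ?B U U"
    using bstar_lincomb2[OF g(3) U U W, of 1 "-1"] bstar_self[OF U W] by simp
  moreover have "?B U U = a\<^sub>0 * ?B U g\<^sub>0 + a\<^sub>1 * ?B U g\<^sub>1"
    using bstar_lincomb2[OF g(1,2) U W, of a\<^sub>0 a\<^sub>1] by (simp add: U_def[symmetric])
  moreover have "?B r g\<^sub>0 = ?B U g\<^sub>0 - (a\<^sub>0 * ?B u\<^sub>0 g\<^sub>0 + a\<^sub>1 * ?B u\<^sub>1 g\<^sub>0)"
    using bstar_lincomb1[OF U s g(1) W, of 1 "-1"] bstar_lincomb1[OF u g(1) W, of a\<^sub>0 a\<^sub>1]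
    by (simp add: r_eq s_def[symmetric])
  moreover have "?B ?e ?d = ?B U g\<^sub>1 - ?B U g\<^sub>0 - ?B u\<^sub>1 g\<^sub>1 + ?B u\<^sub>1 g\<^sub>0"
    using bstar_lincomb1[OF U u(2) d W, of 1 "-1"] bstar_lincomb2[OF g(2,1) U W, of 1 "-1"]
      bstar_lincomb2[OF g(2,1) u(2) W, of 1 "-1"] by simp
  moreover have "h1ip \<Omega> ?W ?W = h1ip \<Omega> G ?W - (a\<^sub>0 * h1ip \<Omega> g\<^sub>0 ?W + a\<^sub>1 * h1ip \<Omega> g\<^sub>1 ?W)"
    using h1ip_lincomb[OF g(3) U W, of 1 "-1"] h1ip_lincomb[OF g(1,2) W, of a\<^sub>0 a\<^sub>1]
    by (simp add: U_def[symmetric])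
  moreover note eq0[OF V(2)] eq1[OF V(2)] eqG[OF V(2)]
  moreover have "a\<^sub>0 = 1 - a\<^sub>1" using a by simp
  \<comment> \<open>With pointwise differences, the equations leave \<open>- a\<^sub>0 * ?B (U -
    u\<^sub>0) g\<^sub>0 - a\<^sub>1 * ?B (U - u\<^sub>1) g\<^sub>1\<close>. Writing
    \<open>g\<^sub>1\<close> as \<open>g\<^sub>0\<close> plus the difference collects
    \<open>r\<close> in front of \<open>g\<^sub>0\<close>, because the weights sum to 1.\<close>
  ultimately have "\<nu> * h1ip \<Omega> ?W ?W = - ?B r g\<^sub>0 - a\<^sub>1 * ?B ?e ?d"
    by algebra
  then have "\<nu> * (h1n \<Omega> ?W)\<^sup>2 \<le> \<bar>?B r g\<^sub>0\<bar> + \<bar>a\<^sub>1\<bar> * \<bar>?B ?e ?d\<bar>"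
    by (simp add: h1ip_self abs_mult[symmetric])
  also have "\<dots> \<le> C3 * C6 * sqrt (L2n \<Omega> r) * sqrt (h1n \<Omega> r) * h1n \<Omega> g\<^sub>0 * h1n \<Omega> ?W
      + \<bar>a\<^sub>1\<bar> * (sqrt CP * C3 * C6 * h1n \<Omega> ?e * h1n \<Omega> ?d * h1n \<Omega> ?W)"
    by (intro add_mono mult_left_mono bstar_bound_interpolated bstar_bound r e d g W) auto
  also have "\<dots> = (C3 * C6 * sqrt (L2n \<Omega> r) * sqrt (h1n \<Omega> r) * h1n \<Omega> g\<^sub>0
      + \<bar>a\<^sub>1\<bar> * (sqrt CP * C3 * C6 * h1n \<Omega> ?e * h1n \<Omega> ?d)) * h1n \<Omega> ?W"
    by (simp add: algebra_simps)
  finally have "\<nu> * h1n \<Omega> ?W \<le> C3 * C6 * sqrt (L2n \<Omega> r) * sqrt (h1n \<Omega> r) * h1n \<Omega> g\<^sub>0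
      + \<bar>a\<^sub>1\<bar> * (sqrt CP * C3 * C6 * h1n \<Omega> ?e * h1n \<Omega> ?d)"
    by (rule absorb_quadratic[OF \<nu>]) (use M in \<open>auto intro!: add_nonneg_nonneg mult_nonneg_nonneg\<close>)
  also have "\<dots> \<le> C3 * C6 * sqrt (L2n \<Omega> r) * sqrt (h1n \<Omega> r) * (hm1n \<Omega> f / \<nu>)
      + \<bar>a\<^sub>1\<bar> * (sqrt CP * C3 * C6 * h1n \<Omega> ?e * h1n \<Omega> ?d)"
    using M picard_stability[OF \<nu> f u(1) g(1) eq0[OF V(1)]]
    by (intro add_right_mono mult_left_mono) auto
  finally show ?thesis .
qed

end

text \<open>The four square roots of the gain factor telescope. The degenerate quotients \<open>x / 0 = 0\<close> are harmless,
  since each of them forces \<open>L\<^sub>\<alpha>\<close> or \<open>H\<^sub>\<alpha>\<close> to vanish.\<close>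

lemma gain_factor_telescope:
  fixes c p L\<^sub>\<alpha> L' L\<^sub>w H\<^sub>\<alpha> H\<^sub>w :: real
  assumes "c \<ge> 0" "p > 0" "L\<^sub>\<alpha> \<ge> 0" "L' \<ge> 0" "L\<^sub>w \<ge> 0" "H\<^sub>\<alpha> \<ge> 0" "H\<^sub>w \<ge> 0"
    and "L' = 0 \<Longrightarrow> H\<^sub>\<alpha> = 0" "L\<^sub>w = 0 \<Longrightarrow> H\<^sub>w = 0" "H\<^sub>w = 0 \<Longrightarrow> H\<^sub>\<alpha> = 0"
  shows "c * sqrt L\<^sub>\<alpha> * sqrt H\<^sub>\<alpha>
    \<le> sqrt p * c * sqrt (L' / L\<^sub>w) * sqrt (H\<^sub>\<alpha> / H\<^sub>w) * sqrt (L\<^sub>\<alpha> / L') * sqrt (L\<^sub>w / (p * H\<^sub>w)) * H\<^sub>w"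
proof (cases "H\<^sub>\<alpha> = 0")
  case True
  then show ?thesis by simp
next
  case False
  then have pos: "L' > 0" "L\<^sub>w > 0" "H\<^sub>w > 0" using assms by (auto simp: order_less_le)
  \<comment> \<open>One factor \<open>H\<^sub>w\<close> is split into two roots, which cancel those
    in the second and fourth denominators.\<close>
  have "sqrt p * c * sqrt (L' / L\<^sub>w) * sqrt (H\<^sub>\<alpha> / H\<^sub>w) * sqrt (L\<^sub>\<alpha> / L') * sqrt (L\<^sub>w / (p * H\<^sub>w)) * H\<^sub>w
      = sqrt p * c * sqrt (L' / L\<^sub>w) * sqrt (H\<^sub>\<alpha> / H\<^sub>w) * sqrt (L\<^sub>\<alpha> / L') * sqrt (L\<^sub>w / (p * H\<^sub>w)) * (sqrt H\<^sub>w * sqrt H\<^sub>w)"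
    using pos by simp
  also have "\<dots> = c * sqrt L\<^sub>\<alpha> * sqrt H\<^sub>\<alpha>"
    using pos assms(2) by (simp only: real_sqrt_divide real_sqrt_mult) (simp add: divide_simps)
  finally show ?thesis by (rule eq_refl[OF sym])
qed

theorem theorem3p2:
  fixes \<Omega> :: "(real^'d::finite) set"
    and Xh :: "(real^'d \<Rightarrow> real^'d) set" and Qh :: "(real^'d \<Rightarrow> real) set"
    and \<beta> \<nu> CP C3 C6 \<sigma> abar K :: real
    and f :: "(real^'d \<Rightarrow> real^'d) \<Rightarrow> real"
    and u ut :: "int \<Rightarrow> real^'d \<Rightarrow> real^'d"
    and \<alpha> h\<alpha> :: "int \<Rightarrow> int \<Rightarrow> real"
    and k :: int
  defines "M \<equiv> sqrt CP * C3 * C6"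
    and "\<kappa> \<equiv> sqrt CP * C3 * C6 * \<nu> powr (-2) * hm1n \<Omega> f"
    and "w \<equiv> aa_w ut u"
    and "e \<equiv> aa_e u"
  assumes dim: "CARD('d) = 2 \<or> CARD('d) = 3"
    and dom: "open \<Omega>" "bounded \<Omega>" "connected \<Omega>"
    and poinc: "\<forall>\<phi>\<in>H10 \<Omega>. L2n \<Omega> \<phi> \<le> CP * h1n \<Omega> \<phi>"
    and sob6: "\<forall>\<phi>\<in>H10 \<Omega>. Lpn 6 \<Omega> \<phi> \<le> C6 * h1n \<Omega> \<phi>"
    and sob3: "\<forall>\<phi>\<in>H10 \<Omega>. Lpn 3 \<Omega> \<phi> \<le> C3 * sqrt (L2n \<Omega> \<phi>) * sqrt (h1n \<Omega> \<phi>)"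
    and Xh: "fin_subspace Xh" "Xh \<subseteq> H10 \<Omega>"
    and Qh: "fin_subspace Qh" "Qh \<subseteq> Q0 \<Omega>"
    and infsup: "\<beta> > 0" "inf_sup \<Omega> Xh Qh \<beta>"
    and nu: "\<nu> > 0"
    and f: "in_Hm1 \<Omega> f"
    and init: "u (-1) \<in> Vh \<Omega> Xh Qh"
    and picard: "\<forall>j\<ge>0. ut j \<in> Vh \<Omega> Xh Qh \<and>
        (\<forall>v\<in>Vh \<Omega> Xh Qh. \<nu> * h1ip \<Omega> (ut j) v + bstar \<Omega> (u (j - 1)) (ut j) v = f v)"
    and first: "u 0 = ut 0"
    and aa: "\<forall>k'\<ge>1. \<alpha> k' (k' - 1) + \<alpha> k' k' = 1
        \<and> (\<forall>a b. a + b = 1 \<longrightarrow>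
             h1n \<Omega> (\<lambda>x. \<alpha> k' (k' - 1) *\<^sub>R w (k' - 1) x + \<alpha> k' k' *\<^sub>R w k' x)
               \<le> h1n \<Omega> (\<lambda>x. a *\<^sub>R w (k' - 1) x + b *\<^sub>R w k' x))
        \<and> u k' = (\<lambda>x. \<alpha> k' (k' - 1) *\<^sub>R ut (k' - 1) x + \<alpha> k' k' *\<^sub>R ut k' x)"
    and aaL2: "\<forall>k'\<ge>1. h\<alpha> k' (k' - 1) + h\<alpha> k' k' = 1
        \<and> (\<forall>a b. a + b = 1 \<longrightarrow>
             L2n \<Omega> (\<lambda>x. h\<alpha> k' (k' - 1) *\<^sub>R w (k' - 1) x + h\<alpha> k' k' *\<^sub>R w k' x)
               \<le> L2n \<Omega> (\<lambda>x. a *\<^sub>R w (k' - 1) x + b *\<^sub>R w k' x))"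
    and sigma: "\<sigma> > 0" "\<forall>j\<ge>0. \<sigma> * h1n \<Omega> (e j) \<le> h1n \<Omega> (\<lambda>x. w (j + 1) x - w j x)"
    and abnd: "\<forall>k'\<ge>1. \<forall>j\<in>{k' - 1, k'}. 0 < \<bar>\<alpha> k' j\<bar> \<and> \<bar>\<alpha> k' j\<bar> < abar"
    and indep: "\<forall>c :: int \<Rightarrow> real.
        h1n \<Omega> (\<lambda>x. \<Sum>j\<in>{1..k}. c j *\<^sub>R (w j x - w (j - 1) x)) = 0 \<longrightarrow> (\<forall>j\<in>{1..k}. c j = 0)"
    and Kbnd: "\<forall>j\<ge>0. h1n \<Omega> (e j) \<le> K * h1n \<Omega> (w j)"
    and k: "k \<ge> 1"
  shows "h1n \<Omega> (w (k + 1)) \<le>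
      \<kappa> * sqrt (L2n \<Omega> (\<lambda>x. h\<alpha> k k *\<^sub>R w k x + h\<alpha> k (k - 1) *\<^sub>R w (k - 1) x) / L2n \<Omega> (w k))
        * sqrt (h1n \<Omega> (\<lambda>x. \<alpha> k k *\<^sub>R w k x + \<alpha> k (k - 1) *\<^sub>R w (k - 1) x) / h1n \<Omega> (w k))
        * sqrt (L2n \<Omega> (\<lambda>x. \<alpha> k k *\<^sub>R w k x + \<alpha> k (k - 1) *\<^sub>R w (k - 1) x)
                / L2n \<Omega> (\<lambda>x. h\<alpha> k k *\<^sub>R w k x + h\<alpha> k (k - 1) *\<^sub>R w (k - 1) x))
        * sqrt (L2n \<Omega> (w k) / (CP * h1n \<Omega> (w k)))
        * h1n \<Omega> (w k)
      + K\<^sup>2 * M * (1 / \<nu>) * \<kappa> * abar * h1n \<Omega> (w k) * h1n \<Omega> (w (k - 1))"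
proof -
  interpret sobolev_domain \<Omega> CP C3 C6
    by unfold_locales (use dom poinc sob6 sob3 in auto)
  let ?V = "Vh \<Omega> Xh Qh"
  have VX: "v \<in> H10 \<Omega>" if "v \<in> ?V" for v using that Xh by (auto simp: Vh_def)
  note V_lin = Vh_lincomb[OF Xh Qh(2)]
  have V_diff: "(\<lambda>x. p x - q x) \<in> ?V" if "p \<in> ?V" "q \<in> ?V" for p q
    using V_lin[OF that, of 1 "-1"] by simp
  have ut: "ut j \<in> ?V" if "j \<ge> 0" for j using picard that by blast
  \<comment> \<open>Indices start at -1: \<open>u 0 = ut 0\<close> is the Picard update of
    \<open>u (-1)\<close>, so the first residual is \<open>w 0\<close>.\<close>
  have u: "u j \<in> ?V" if j: "j \<ge> -1" for j
  proof -
    consider "j = -1" | "j = 0" | "j \<ge> 1" using j by linarith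
    then show ?thesis
    proof cases
      case 3
      then have "u j = (\<lambda>x. \<alpha> j (j - 1) *\<^sub>R ut (j - 1) x + \<alpha> j j *\<^sub>R ut j x)" using aa by blast
      then show ?thesis using V_lin[OF ut ut] 3 by simp
    qed (use init first ut in auto)
  qed
  have w: "w j \<in> ?V" if "j \<ge> 0" for j
    unfolding w_def aa_w_def using that by (intro V_diff ut u) auto
  \<comment> \<open>The newest residual comes first, as in the goal; the minimality statements list
    the two in the opposite order.\<close>
  define r where "r = (\<lambda>x. \<alpha> k k *\<^sub>R w k x + \<alpha> k (k - 1) *\<^sub>R w (k - 1) x)"
  define r' where "r' = (\<lambda>x. h\<alpha> k k *\<^sub>R w k x + h\<alpha> k (k - 1) *\<^sub>R w (k - 1) x)"
  have rV: "r \<in> ?V" "r' \<in> ?V" unfolding r_def r'_def using k by (intro V_lin w; simp)+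
  have goal: "h1n \<Omega> (w (k + 1)) \<le>
      \<kappa> * sqrt (L2n \<Omega> r' / L2n \<Omega> (w k)) * sqrt (h1n \<Omega> r / h1n \<Omega> (w k))
        * sqrt (L2n \<Omega> r / L2n \<Omega> r') * sqrt (L2n \<Omega> (w k) / (CP * h1n \<Omega> (w k))) * h1n \<Omega> (w k)
      + K\<^sup>2 * M * (1 / \<nu>) * \<kappa> * abar * h1n \<Omega> (w k) * h1n \<Omega> (w (k - 1))"
  \<comment> \<open>If all gradient norms vanish, both sides of the goal are zero, whereas the
    supremum in \<open>hm1n\<close> would range over the empty set.\<close>
  proof (cases "\<forall>\<phi>\<in>H10 \<Omega>. h1n \<Omega> \<phi> = 0")
    case True
    then have "h1n \<Omega> (w j) = 0" if "j \<ge> 0" for j using VX[OF w[OF that]] by blast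
    then show ?thesis using k by simp
  next
    case False
    then obtain \<phi> where \<phi>: "\<phi> \<in> H10 \<Omega>" "h1n \<Omega> \<phi> \<noteq> 0" by blast
    note c = constants_nonneg[OF \<phi>]
    have "0 \<le> hm1n \<Omega> f * h1n \<Omega> \<phi>" using hm1n_bound[OF f \<phi>(1)] by linarith
    then have F: "hm1n \<Omega> f \<ge> 0" using \<phi>(2) h1n_nonneg[of \<phi>] by (simp add: zero_le_mult_iff)
    have M: "M \<ge> 0" using c by (simp add: M_def)
    have \<kappa>: "\<kappa> = M * hm1n \<Omega> f / \<nu>\<^sup>2"
      using nu by (simp add: \<kappa>_def M_def powr_minus_divide)
    have \<kappa>_nonneg: "\<kappa> \<ge> 0" using M F by (simp add: \<kappa>)
    have sol: "\<nu> * h1ip \<Omega> (ut j) v + bstar \<Omega> (u (j - 1)) (ut j) v = f v" if "j \<ge> 0" "v \<in> ?V" for j v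
      using picard that by blast
    note aak = aa[rule_format, OF k]
    have uk: "u k = (\<lambda>x. \<alpha> k (k - 1) *\<^sub>R ut (k - 1) x + \<alpha> k k *\<^sub>R ut k x)"
      and ak: "\<alpha> k (k - 1) + \<alpha> k k = 1" using aak by auto
    \<comment> \<open>For \<open>k = 1\<close> the oldest iterate \<open>u (k - 2)\<close> is the
      initial \<open>u (-1)\<close>.\<close>
    have H: "ut (k - 1) \<in> H10 \<Omega>" "ut k \<in> H10 \<Omega>" "ut (k + 1) \<in> H10 \<Omega>" "u (k - 2) \<in> H10 \<Omega>" "u (k - 1) \<in> H10 \<Omega>"
      using k by (auto intro!: VX ut u)
    have wk1: "w (k + 1) = (\<lambda>x. ut (k + 1) x - u k x)" by (simp add: w_def aa_w_def)
    have r_eq: "r = (\<lambda>x. \<alpha> k (k - 1) *\<^sub>R (ut (k - 1) x - u (k - 2) x) + \<alpha> k k *\<^sub>R (ut k x - u (k - 1) x))"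
      by (simp add: r_def w_def aa_w_def add.commute)
    have e: "e k = (\<lambda>x. u k x - u (k - 1) x)" "e (k - 1) = (\<lambda>x. u (k - 1) x - u (k - 2) x)"
      by (simp_all add: e_def aa_e_def)
    have 1: "\<nu> * h1n \<Omega> (w (k + 1)) \<le> C3 * C6 * sqrt (L2n \<Omega> r) * sqrt (h1n \<Omega> r) * (hm1n \<Omega> f / \<nu>)
        + \<bar>\<alpha> k k\<bar> * (M * h1n \<Omega> (e k) * h1n \<Omega> (\<lambda>x. ut k x - ut (k - 1) x))"
      unfolding wk1 r_eq e(1) uk M_def
      by (rule anderson_residual_bound[where V="?V", OF nu f F c(2,3) _ H(4,5,1,2,3) ak])
        (use k sol[of k] sol[of "k - 1"] sol[of "k + 1"] c in \<open>auto intro!: ut u V_diff V_lin simp: uk\<close>)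
    \<comment> \<open>\<open>ut k\<close> and \<open>ut (k - 1)\<close> are the Picard images of
      \<open>u (k - 1)\<close> and \<open>u (k - 2)\<close>, whose difference is
      \<open>e (k - 1)\<close>.\<close>
    have 2: "h1n \<Omega> (\<lambda>x. ut k x - ut (k - 1) x) \<le> \<kappa> * h1n \<Omega> (e (k - 1))"
    proof -
      have "\<nu>\<^sup>2 * h1n \<Omega> (\<lambda>x. ut k x - ut (k - 1) x) \<le> M * hm1n \<Omega> f * h1n \<Omega> (e (k - 1))"
        unfolding e(2) M_def
        by (rule picard_lipschitz[where V="?V", OF nu f F M[unfolded M_def] H(5,4,2,1)])
          (use k sol[of k] sol[of "k - 1"] in \<open>auto intro!: ut V_diff\<close>)
      then show ?thesis using nu by (simp add: \<kappa> field_simps)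
    qed
    have Ke: "h1n \<Omega> (e k) \<le> K * h1n \<Omega> (w k)" "h1n \<Omega> (e (k - 1)) \<le> K * h1n \<Omega> (w (k - 1))"
      using Kbnd k by auto
    \<comment> \<open>\<open>K\<close> comes without a sign, but these products dominate
      norms.\<close>
    have Kw: "0 \<le> K * h1n \<Omega> (w k)" "0 \<le> K * h1n \<Omega> (w (k - 1))"
      using order_trans[OF h1n_nonneg Ke(1)] order_trans[OF h1n_nonneg Ke(2)] by auto
    have a: "\<bar>\<alpha> k k\<bar> \<le> abar" using abnd k by fastforce
    have "M * h1n \<Omega> (e k) * h1n \<Omega> (\<lambda>x. ut k x - ut (k - 1) x)
        \<le> M * (K * h1n \<Omega> (w k)) * (\<kappa> * (K * h1n \<Omega> (w (k - 1))))"
      by (rule mult_mono[OF mult_left_mono[OF Ke(1) M] order_trans[OF 2 mult_left_mono[OF Ke(2) \<kappa>_nonneg]]])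
        (use mult_nonneg_nonneg[OF M Kw(1)] in auto)
    then have "\<bar>\<alpha> k k\<bar> * (M * h1n \<Omega> (e k) * h1n \<Omega> (\<lambda>x. ut k x - ut (k - 1) x))
        \<le> abar * (M * (K * h1n \<Omega> (w k)) * (\<kappa> * (K * h1n \<Omega> (w (k - 1)))))"
      by (rule mult_mono[OF a]) (use a M in auto)
    with 1 have "\<nu> * h1n \<Omega> (w (k + 1)) \<le> C3 * C6 * sqrt (L2n \<Omega> r) * sqrt (h1n \<Omega> r) * (hm1n \<Omega> f / \<nu>)
        + abar * (M * (K * h1n \<Omega> (w k)) * (\<kappa> * (K * h1n \<Omega> (w (k - 1)))))"
      by linarith
    then have 3: "h1n \<Omega> (w (k + 1)) \<le> (C3 * C6 * hm1n \<Omega> f / \<nu>\<^sup>2) * sqrt (L2n \<Omega> r) * sqrt (h1n \<Omega> r)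
        + K\<^sup>2 * M * (1 / \<nu>) * \<kappa> * abar * h1n \<Omega> (w k) * h1n \<Omega> (w (k - 1))"
      using nu by (simp add: field_simps power2_eq_square)
    have min: "h1n \<Omega> r \<le> h1n \<Omega> (\<lambda>x. a *\<^sub>R w (k - 1) x + b *\<^sub>R w k x)" if "a + b = 1" for a b
      using aak that by (simp add: r_def add.commute)
    \<comment> \<open>Comparing \<open>r\<close> with \<open>w k\<close> (weights 0 and 1) and then
      with \<open>r'\<close> (the L2-optimal weights) controls the denominators: if either
      competitor has gradient norm zero, so has \<open>r\<close>.\<close>
    have "h1n \<Omega> r \<le> h1n \<Omega> (w k)" using min[of 0 1] by simp
    moreover have "h1n \<Omega> r \<le> h1n \<Omega> r'"
      using min aaL2[rule_format, OF k] by (simp add: r'_def add.commute)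
    ultimately have "(C3 * C6 * hm1n \<Omega> f / \<nu>\<^sup>2) * sqrt (L2n \<Omega> r) * sqrt (h1n \<Omega> r)
      \<le> sqrt CP * (C3 * C6 * hm1n \<Omega> f / \<nu>\<^sup>2) * sqrt (L2n \<Omega> r' / L2n \<Omega> (w k)) * sqrt (h1n \<Omega> r / h1n \<Omega> (w k))
        * sqrt (L2n \<Omega> r / L2n \<Omega> r') * sqrt (L2n \<Omega> (w k) / (CP * h1n \<Omega> (w k))) * h1n \<Omega> (w k)"
      using c F h1n_eq_0_of_L2n_eq_0[OF VX[OF rV(2)]] h1n_eq_0_of_L2n_eq_0[OF VX[OF w[of k]]] k
        h1n_nonneg[of r]
      by (intro gain_factor_telescope) (auto intro: order_antisym)
    also have "sqrt CP * (C3 * C6 * hm1n \<Omega> f / \<nu>\<^sup>2) = \<kappa>" by (simp add: \<kappa> M_def)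
    finally show ?thesis using 3 by linarith
  qed
  then show ?thesis unfolding r_def r'_def .
qed

end
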